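(* Let $\Box=[0,1]\times[0,1]$ and let $1\le p\le\infty$. Regard each (almost everywhere defined) function $f$ on $\Box$ as extended to $\mathbb{R}\times\mathbb{R}$ via the twisted-periodicity relations $f(a+1,c)=f(a,c)$ and $f(a,c+1)=e^{-2\pi i a}f(a,c)$. For $m\ge 1$ define \[{\rm T}_m f(a,c)=\frac1m\sum_{k=0}^{m-1} f\Big(\frac{a+k}{m},mc\Big),\qquad {\rm S}_m f(a,c)=\frac1m\sum_{k=0}^{m-1}e^{2\pi i k a} f\Big(ma,\frac{c+k}{m}\Big),\] \[{\rm T}_m^{\vee} f(a,c)=\frac1m\sum_{k=0}^{m-1}e^{2\pi i\frac{(1-m)a+k}{m}} f\Big(\frac{a+k}{m},1+m(c-1)\Big),\qquad {\rm S}_m^{\vee} f(a,c)=\frac1m\sum_{k=0}^{m-1}e^{2\pi i(m-(k+1))a} f\Big(1+m(a-1),\frac{c+m-(k+1)}{m}\Big).\] Then: (1) The four families $\{{\rm T}_m,{\rm S}_m,{\rm T}_m^{\vee},{\rm S}_m^{\vee}: m\ge1\}$ continuously extend to bounded operators on $L^p(\Box,da\,dc)$, and these operators satisfy ${\rm T}_m={\rm T}_m^{\vee}$, ${\rm S}_m={\rm S}_m^{\vee}$ and ${\rm S}_m=\frac1m({\rm T}_m)^{-1}$ for all $m\ge1$ (in particular ${\rm T}_m$ is invertible). (2) The $\mathbb{C}$-algebra $\mathcal{A}_0^p$ of operators on $L^p(\Box,da\,dc)$ generated by these four families under addition and operator multiplication is commutative. (3) On $L^2(\Box,da\,dc)$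 the adjoints satisfy $({\rm T}_m)^*={\rm S}_m$ and $({\rm S}_m)^*={\rm T}_m$; in particular $\mathcal{A}_0^2$ is a $\star$-algebra. Moreover each of $\sqrt m\,{\rm T}_m$ and $\sqrt m\,{\rm S}_m$ is a unitary operator on $L^2(\Box,da\,dc)$.
   Context: The operators ${\rm S}_m,{\rm T}_m^\vee,{\rm S}_m^\vee$ are the conjugates ${\rm R}{\rm T}_m{\rm R}^{-1}$, ${\rm R}^2{\rm T}_m{\rm R}^{-2}$, ${\rm R}^3{\rm T}_m{\rm R}^{-3}$ of ${\rm T}_m$ by powers of the operator ${\rm R}(F)(a,c)=e^{-2\pi i a c}F(1-c,a)$, which satisfies ${\rm R}^4={\rm I}$; the explicit formulas are as given in the claim. *)

theory Defs
  imports "HOL-Analysis.Analysis" "HOL-Probability.Essential_Supremum"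
begin

section \<open>Almost everywhere defined functions on the unit square\<close>

definition box_measure :: "(real \<times> real) measure" where
  "box_measure = lebesgue_on ({0..1} \<times> {0..1})"

text \<open>Elements are classes of arbitrary functions, not only of measurable ones. Since
  \<open>box_measure\<close> is complete, measurability does not depend on the representative; it is imposed
  in the definition of \<open>Lp\<close> below.\<close>

quotient_type ae_fun = "real \<times> real \<Rightarrow> complex" /
    "\<lambda>f g. AE x in box_measure. f x = g x"
  morphisms ae_rep ae_class
proof (rule equivpI)
  show "reflp (\<lambda>f g :: real \<times> real \<Rightarrow> complex. AE x in box_measure. f x = g x)"
    by (simp add: reflp_def)
  show "symp (\<lambda>f g :: real \<times> real \<Rightarrow> complex. AE x in box_measure. f x = g x)"
    by (simp add: symp_def eq_commute)
  show "transp (\<lambda>f g :: real \<times> real \<Rightarrow> complex. AE x in box_measure. f x = g x)"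
    unfolding transp_def
  proof (intro allI impI)
    fix f g h :: "real \<times> real \<Rightarrow> complex"
    assume "AE x in box_measure. f x = g x" "AE x in box_measure. g x = h x"
    then show "AE x in box_measure. f x = h x"
      by eventually_elim simp
  qed
qed

instantiation ae_fun :: ab_group_add
begin

lift_definition zero_ae_fun :: ae_fun is "\<lambda>_. 0" .

lift_definition plus_ae_fun :: "ae_fun \<Rightarrow> ae_fun \<Rightarrow> ae_fun" is "\<lambda>f g x. f x + g x"
  by (elim eventually_rev_mp) (auto intro!: always_eventually)

lift_definition uminus_ae_fun :: "ae_fun \<Rightarrow> ae_fun" is "\<lambda>f x. - f x"
  by auto

lift_definition minus_ae_fun :: "ae_fun \<Rightarrow> ae_fun \<Rightarrow> ae_fun" is "\<lambda>f g x. f x - g x"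
  by (elim eventually_rev_mp) (auto intro!: always_eventually)

instance
  by standard (transfer; simp add: algebra_simps)+

end

lift_definition ae_scale :: "complex \<Rightarrow> ae_fun \<Rightarrow> ae_fun" is "\<lambda>c f x. c * f x"
  by (auto elim: eventually_mono)

lemma vector_space_ae_scale: "vector_space ae_scale"
  by standard (transfer; simp add: algebra_simps)+


section \<open>The spaces \<open>L\<^sup>p\<close>\<close>

lemma complete_box_measure: "complete_measure box_measure"
proof
  fix A B assume AB: "B \<subseteq> A" "A \<in> null_sets box_measure"
  have S: "{0..1} \<times> {0..1} \<in> sets (lebesgue :: (real \<times> real) measure)"
    by (metis borel_closed closed_Times closed_atLeastAtMost sets_completionI_sets sets_lborel)
  have "B \<in> null_sets box_measure"
    using AB unfolding box_measure_def null_sets_restrict_space[OF S]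
    by (meson completion.complete2 order_trans)
  then show "B \<in> sets box_measure" by auto
qed

lemma measurable_box_AE_cong:
  assumes "AE x in box_measure. f x = g x"
  shows "f \<in> borel_measurable box_measure \<longleftrightarrow> g \<in> borel_measurable box_measure"
proof -
  interpret complete_measure box_measure by (rule complete_box_measure)
  have *: "g \<in> borel_measurable box_measure"
    if ae: "AE x in box_measure. f x = g x" and f: "f \<in> borel_measurable box_measure"
    for f g :: "real \<times> real \<Rightarrow> 'a"
  proof (rule measurableI)
    fix A :: "'a set" assume A: "A \<in> sets borel"
    have ae': "AE x in box_measure.
        x \<in> f -` A \<inter> space box_measure \<longleftrightarrow> x \<in> g -` A \<inter> space box_measure"
      using ae by eventually_elim auto
    show "g -` A \<inter> space box_measure \<in> sets box_measure"
      by (rule in_sets_AE[OF ae' measurable_sets[OF f A]]) auto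
  qed auto
  have "AE x in box_measure. g x = f x" using assms by eventually_elim simp
  then show ?thesis using *[of f g] *[of g f] assms by blast
qed

lemma integral_box_AE_cong:
  fixes f g :: "real \<times> real \<Rightarrow> complex"
  assumes "AE x in box_measure. f x = g x"
  shows "(LINT x|box_measure. f x) = (LINT x|box_measure. g x)"
proof (cases "f \<in> borel_measurable box_measure")
  case True
  then show ?thesis
    using measurable_box_AE_cong[OF assms] assms by (intro integral_cong_AE) auto
next
  case False
  then have "\<not> integrable box_measure f" "\<not> integrable box_measure g"
    using measurable_box_AE_cong[OF assms] by auto
  then show ?thesis by (simp add: not_integrable_integral_eq)
qed

lemma esssup_box_AE_cong:
  assumes "AE x in box_measure. f x = g x"
  shows "esssup box_measure f = esssup box_measure g"
  using assms measurable_box_AE_cong[OF assms]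
  by (cases "f \<in> borel_measurable box_measure") (auto simp: esssup_non_measurable intro: esssup_AE_cong)

lift_definition Lp_mem :: "ennreal \<Rightarrow> ae_fun \<Rightarrow> bool" is
  "\<lambda>p f. f \<in> borel_measurable box_measure \<and>
     (if p = \<infinity> then esssup box_measure (\<lambda>x. ennreal (norm (f x))) < \<infinity>
      else (\<integral>\<^sup>+x. ennreal (norm (f x) powr enn2real p) \<partial>box_measure) < \<infinity>)"
  subgoal premises ae for p f g
  proof -
    have 1: "AE x in box_measure. ennreal (norm (f x)) = ennreal (norm (g x))"
      using ae by eventually_elim simp
    have 2: "AE x in box_measure.
        ennreal (norm (f x) powr enn2real p) = ennreal (norm (g x) powr enn2real p)"
      using ae by eventually_elim simp
    show ?thesis
      using measurable_box_AE_cong[OF ae] esssup_box_AE_cong[OF 1] nn_integral_cong_AE[OF 2]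
      by simp
  qed
  done

definition Lp :: "ennreal \<Rightarrow> ae_fun set" where
  "Lp p = {u. Lp_mem p u}"

lift_definition Lp_norm :: "ennreal \<Rightarrow> ae_fun \<Rightarrow> real" is
  "\<lambda>p f. if p = \<infinity> then enn2real (esssup box_measure (\<lambda>x. ennreal (norm (f x))))
     else enn2real (\<integral>\<^sup>+x. ennreal (norm (f x) powr enn2real p) \<partial>box_measure) powr (1 / enn2real p)"
  subgoal premises ae for p f g
  proof -
    have 1: "AE x in box_measure. ennreal (norm (f x)) = ennreal (norm (g x))"
      using ae by eventually_elim simp
    have 2: "AE x in box_measure.
        ennreal (norm (f x) powr enn2real p) = ennreal (norm (g x) powr enn2real p)"
      using ae by eventually_elim simp
    show ?thesis
      using esssup_box_AE_cong[OF 1] nn_integral_cong_AE[OF 2] by simp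
  qed
  done

lift_definition L2_inner :: "ae_fun \<Rightarrow> ae_fun \<Rightarrow> complex" is
  "\<lambda>f g. LINT x|box_measure. f x * cnj (g x)"
  subgoal premises ae for f f' g g'
    by (rule integral_box_AE_cong) (use ae in eventually_elim, simp)
  done


section \<open>Operators on \<open>L\<^sup>p\<close>\<close>

text \<open>Operators on \<open>L\<^sup>p\<close> are extensional functions (\<open>undefined\<close> outside \<open>Lp p\<close>), so that HOL
  equality is equality of operators.\<close>

type_synonym lp_operator = "ae_fun \<Rightarrow> ae_fun"

definition bounded_ops :: "ennreal \<Rightarrow> lp_operator set" where
  "bounded_ops p = {A \<in> Lp p \<rightarrow>\<^sub>E Lp p.
     (\<forall>u\<in>Lp p. \<forall>v\<in>Lp p. A (u + v) = A u + A v) \<and>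
     (\<forall>c. \<forall>u\<in>Lp p. A (ae_scale c u) = ae_scale c (A u)) \<and>
     (\<exists>K. \<forall>u\<in>Lp p. Lp_norm p (A u) \<le> K * Lp_norm p u)}"

definition op_id :: "ennreal \<Rightarrow> lp_operator" where
  "op_id p = (\<lambda>u\<in>Lp p. u)"

definition op_zero :: "ennreal \<Rightarrow> lp_operator" where
  "op_zero p = (\<lambda>u\<in>Lp p. 0)"

definition op_add :: "ennreal \<Rightarrow> lp_operator \<Rightarrow> lp_operator \<Rightarrow> lp_operator" where
  "op_add p A B = (\<lambda>u\<in>Lp p. A u + B u)"

definition op_scale :: "ennreal \<Rightarrow> complex \<Rightarrow> lp_operator \<Rightarrow> lp_operator" where
  "op_scale p c A = (\<lambda>u\<in>Lp p. ae_scale c (A u))"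

definition op_mult :: "ennreal \<Rightarrow> lp_operator \<Rightarrow> lp_operator \<Rightarrow> lp_operator" where
  "op_mult p A B = compose (Lp p) A B"

definition invertible_op :: "ennreal \<Rightarrow> lp_operator \<Rightarrow> bool" where
  "invertible_op p A \<longleftrightarrow> A \<in> bounded_ops p \<and>
     (\<exists>B\<in>bounded_ops p. op_mult p A B = op_id p \<and> op_mult p B A = op_id p)"

definition op_inverse :: "ennreal \<Rightarrow> lp_operator \<Rightarrow> lp_operator" where
  "op_inverse p A = (\<lambda>u\<in>Lp p. inv_into (Lp p) A u)"

definition operator_algebra :: "ennreal \<Rightarrow> lp_operator set \<Rightarrow> bool" where
  "operator_algebra p X \<longleftrightarrow> X \<subseteq> bounded_ops p \<and> op_zero p \<in> X \<and>
     (\<forall>A\<in>X. \<forall>B\<in>X. op_add p A B \<in> X \<and> op_mult p A B \<in> X) \<and>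
     (\<forall>c. \<forall>A\<in>X. op_scale p c A \<in> X)"

definition commutative_ops :: "ennreal \<Rightarrow> lp_operator set \<Rightarrow> bool" where
  "commutative_ops p X \<longleftrightarrow> (\<forall>A\<in>X. \<forall>B\<in>X. op_mult p A B = op_mult p B A)"

inductive_set generated_algebra :: "ennreal \<Rightarrow> lp_operator set \<Rightarrow> lp_operator set"
  for p :: ennreal and G :: "lp_operator set" where
  zero: "op_zero p \<in> generated_algebra p G"
| gen: "A \<in> G \<Longrightarrow> A \<in> generated_algebra p G"
| add: "A \<in> generated_algebra p G \<Longrightarrow> B \<in> generated_algebra p G \<Longrightarrow>
    op_add p A B \<in> generated_algebra p G"
| scale: "A \<in> generated_algebra p G \<Longrightarrow> op_scale p c A \<in> generated_algebra p G"
| mult: "A \<in> generated_algebra p G \<Longrightarrow> B \<in> generated_algebra p G \<Longrightarrow>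
    op_mult p A B \<in> generated_algebra p G"

definition is_adjoint :: "lp_operator \<Rightarrow> lp_operator \<Rightarrow> bool" where
  "is_adjoint A B \<longleftrightarrow> A \<in> bounded_ops 2 \<and> B \<in> bounded_ops 2 \<and>
     (\<forall>u\<in>Lp 2. \<forall>v\<in>Lp 2. L2_inner (A u) v = L2_inner u (B v))"

definition star_algebra :: "lp_operator set \<Rightarrow> bool" where
  "star_algebra X \<longleftrightarrow> operator_algebra 2 X \<and> (\<forall>A\<in>X. \<exists>B\<in>X. is_adjoint A B)"

definition unitary_op :: "lp_operator \<Rightarrow> bool" where
  "unitary_op A \<longleftrightarrow>
     (\<exists>B. is_adjoint A B \<and> op_mult 2 A B = op_id 2 \<and> op_mult 2 B A = op_id 2)"

text \<open>A pointwise formula \<open>\<Phi>\<close> is applied to a representative. That the result does not depend on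
  the chosen representative is part of \<open>extends_to_bounded\<close>.\<close>

definition Lp_op :: "ennreal \<Rightarrow> ((real \<times> real \<Rightarrow> complex) \<Rightarrow> (real \<times> real \<Rightarrow> complex)) \<Rightarrow> lp_operator"
  where "Lp_op p \<Phi> = (\<lambda>u\<in>Lp p. ae_class (\<Phi> (ae_rep u)))"

definition extends_to_bounded ::
    "ennreal \<Rightarrow> ((real \<times> real \<Rightarrow> complex) \<Rightarrow> (real \<times> real \<Rightarrow> complex)) \<Rightarrow> bool" where
  "extends_to_bounded p \<Phi> \<longleftrightarrow> Lp_op p \<Phi> \<in> bounded_ops p \<and>
     (\<forall>f. ae_class f \<in> Lp p \<longrightarrow> Lp_op p \<Phi> (ae_class f) = ae_class (\<Phi> f))"


section \<open>Two-variable Hecke operators\<close>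

definition expi2pi :: "real \<Rightarrow> complex" where
  "expi2pi x = exp (2 * of_real pi * \<i> * of_real x)"

text \<open>The twisted-periodic extension to the plane. It uses only the values on the half-open
  square, because the two relations need not be compatible with given values on the closed square;
  the discarded sides have measure zero.\<close>

definition twisted_ext :: "(real \<times> real \<Rightarrow> complex) \<Rightarrow> real \<Rightarrow> real \<Rightarrow> complex" where
  "twisted_ext f a c = expi2pi (- (a * of_int \<lfloor>c\<rfloor>)) * f (frac a, frac c)"

lemma expi2pi_add: "expi2pi (x + y) = expi2pi x * expi2pi y"
  by (simp add: expi2pi_def ring_distribs exp_add)

lemma expi2pi_of_int: "expi2pi (of_int n) = 1"
proof -
  have "expi2pi (of_int n) = exp ((2 * of_int n * pi) * \<i>)"
    by (simp add: expi2pi_def mult_ac)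
  also have "\<dots> = 1" by (subst exp_eq_1) auto
  finally show ?thesis .
qed

lemma twisted_ext_square:
  "0 \<le> a \<Longrightarrow> a < 1 \<Longrightarrow> 0 \<le> c \<Longrightarrow> c < 1 \<Longrightarrow> twisted_ext f a c = f (a, c)"
  using floor_unique[of 0 c] by (simp add: twisted_ext_def frac_eq[THEN iffD2] expi2pi_def)

lemma twisted_ext_shift_fst: "twisted_ext f (a + 1) c = twisted_ext f a c"
proof -
  have "expi2pi (- ((a + 1) * of_int \<lfloor>c\<rfloor>)) = expi2pi (- (a * of_int \<lfloor>c\<rfloor>) + of_int (- \<lfloor>c\<rfloor>))"
    by (simp add: algebra_simps)
  then have "expi2pi (- ((a + 1) * of_int \<lfloor>c\<rfloor>)) = expi2pi (- (a * of_int \<lfloor>c\<rfloor>))"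
    by (simp only: expi2pi_add expi2pi_of_int mult_1_right)
  then show ?thesis by (simp add: twisted_ext_def frac_1_eq)
qed

lemma twisted_ext_shift_snd: "twisted_ext f a (c + 1) = expi2pi (- a) * twisted_ext f a c"
proof -
  have "expi2pi (- (a * of_int \<lfloor>c + 1\<rfloor>)) = expi2pi (- a + - (a * of_int \<lfloor>c\<rfloor>))"
    by (simp add: algebra_simps)
  also have "\<dots> = expi2pi (- a) * expi2pi (- (a * of_int \<lfloor>c\<rfloor>))" by (rule expi2pi_add)
  finally show ?thesis by (simp add: twisted_ext_def frac_1_eq)
qed

definition hecke_T :: "nat \<Rightarrow> (real \<times> real \<Rightarrow> complex) \<Rightarrow> (real \<times> real \<Rightarrow> complex)" where
  "hecke_T m f = (\<lambda>(a, c). 1 / of_nat m *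
     (\<Sum>k = 0..<m. twisted_ext f ((a + real k) / real m) (real m * c)))"

definition hecke_S :: "nat \<Rightarrow> (real \<times> real \<Rightarrow> complex) \<Rightarrow> (real \<times> real \<Rightarrow> complex)" where
  "hecke_S m f = (\<lambda>(a, c). 1 / of_nat m *
     (\<Sum>k = 0..<m. expi2pi (real k * a) * twisted_ext f (real m * a) ((c + real k) / real m)))"

definition hecke_T_vee :: "nat \<Rightarrow> (real \<times> real \<Rightarrow> complex) \<Rightarrow> (real \<times> real \<Rightarrow> complex)" where
  "hecke_T_vee m f = (\<lambda>(a, c). 1 / of_nat m *
     (\<Sum>k = 0..<m. expi2pi (((1 - real m) * a + real k) / real m) *
        twisted_ext f ((a + real k) / real m) (1 + real m * (c - 1))))"

definition hecke_S_vee :: "nat \<Rightarrow> (real \<times> real \<Rightarrow> complex) \<Rightarrow> (real \<times> real \<Rightarrow> complex)" where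
  "hecke_S_vee m f = (\<lambda>(a, c). 1 / of_nat m *
     (\<Sum>k = 0..<m. expi2pi ((real m - (real k + 1)) * a) *
        twisted_ext f (1 + real m * (a - 1)) ((c + real m - (real k + 1)) / real m)))"

definition T_op :: "ennreal \<Rightarrow> nat \<Rightarrow> lp_operator" where
  "T_op p m = Lp_op p (hecke_T m)"

definition S_op :: "ennreal \<Rightarrow> nat \<Rightarrow> lp_operator" where
  "S_op p m = Lp_op p (hecke_S m)"

definition T_vee_op :: "ennreal \<Rightarrow> nat \<Rightarrow> lp_operator" where
  "T_vee_op p m = Lp_op p (hecke_T_vee m)"

definition S_vee_op :: "ennreal \<Rightarrow> nat \<Rightarrow> lp_operator" where
  "S_vee_op p m = Lp_op p (hecke_S_vee m)"

definition hecke_algebra :: "ennreal \<Rightarrow> lp_operator set" where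
  "hecke_algebra p = generated_algebra p
     (\<Union>m\<in>{1..}. {T_op p m, S_op p m, T_vee_op p m, S_vee_op p m})"

end

theory Submission
  imports Defs
begin

text \<open>On functions that are twisted-periodic on the whole plane the formulas for \<open>T\<^sub>m\<close> and \<open>S\<^sub>m\<close> again
  produce twisted-periodic functions, so all algebraic relations can be checked pointwise:
  \<open>T\<^sub>m T\<^sub>n = T\<^sub>m\<^sub>n\<close> by regrouping the sum, and \<open>T\<^sub>m S\<^sub>m = S\<^sub>m T\<^sub>m = 1/m\<close> by orthogonality of the
  \<open>m\<close>-th roots of unity. Operators commuting with \<open>T\<^sub>n\<close> commute with \<open>S\<^sub>n\<close>, a multiple of its inverse,
  which gives commutativity of the whole algebra. For the adjoints, let \<open>F\<close> and \<open>G\<close> be the extensions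
  of \<open>f\<close> and \<open>g\<close> and put \<open>P(a, c) = F(a, mc) cnj (G(ma, c))\<close>. Both \<open>\<langle>T\<^sub>m f, g\<rangle>\<close> and
  \<open>\<langle>f, S\<^sub>m g\<rangle>\<close> equal the integral of \<open>P\<close> over the square, cut into \<open>m\<close> vertical strips for the first
  and \<open>m\<close> horizontal strips for the second.\<close>

section \<open>Roots of unity\<close>

text \<open>The formulas act on representatives, and each application passes through
  \<open>twisted_ext\<close>, which forgets all values outside the half-open square. A composite
  therefore contains the extension of an intermediate image; the pointwise algebra works because
  this image is already twisted-periodic, so that extending it changes nothing. In the algebraic
  relations, almost everywhere equality enters only when \<open>twisted_ext f\<close> is identified
  with \<open>f\<close> on the square. Boundedness rests on one estimate. Each summand is a bounded
  weight times the extension composed with an affine map of nonzero slopes. The twisting factor has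
  modulus 1, so the absolute value of the extension is periodic under integer translations. The
  affine image of the square meets finitely many unit cells, and a change of variables on each
  yields a constant independent of the function. Preimages of null sets under such maps are null,
  which gives independence of the representative. Unitarity comes from algebra and not from a norm
  computation: S_m is both the adjoint of T_m and 1/m times its inverse.\<close>

lemma norm_expi2pi [simp]: "norm (expi2pi x) = 1"
  using norm_exp_i_times[of "2 * pi * x"] by (simp add: expi2pi_def mult_ac)

lemma cnj_expi2pi: "cnj (expi2pi x) = expi2pi (- x)"
  by (simp add: expi2pi_def exp_cnj)

lemma expi2pi_power: "expi2pi x ^ k = expi2pi (real k * x)"
  by (simp add: expi2pi_def exp_of_nat_mult[symmetric] mult_ac)

text \<open>A unit shift of one variable turns the term of index \<open>k\<close> into that of index
  \<open>k + 1\<close>; when the term \<open>m\<close> wraps around to the term 0, the sum is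
  unchanged.\<close>

lemma sum_cyclic_shift:
  fixes g :: "nat \<Rightarrow> 'a::cancel_comm_monoid_add"
  assumes "g m = g 0"
  shows "(\<Sum>k<m. g (Suc k)) = (\<Sum>k<m. g k)"
proof -
  have "g 0 + (\<Sum>k<m. g (Suc k)) = g m + (\<Sum>k<m. g k)"
    by (metis add.commute sum.lessThan_Suc sum.lessThan_Suc_shift)
  then show ?thesis using assms by simp
qed

text \<open>The summands are the powers of an \<open>m\<close>-th root of unity which is 1 exactly
  when \<open>m\<close> divides \<open>i\<close>; otherwise the geometric series vanishes.\<close>

lemma sum_expi2pi_roots:
  assumes "m > 0"
  shows "(\<Sum>k<m. expi2pi (real_of_int i * real k / real m)) = (if int m dvd i then of_nat m else 0)"
proof (cases "int m dvd i")
  case True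
  then obtain j where j: "i = int m * j" by (auto elim: dvdE)
  have "expi2pi (real_of_int i * real k / real m) = 1" for k
    using expi2pi_of_int[of "j * int k"] assms by (simp add: j)
  then show ?thesis using True by simp
next
  case False
  define z where "z = expi2pi (real_of_int i / real m)"
  have "z \<noteq> 1"
  proof
    assume "z = 1"
    then obtain n :: int where "2 * pi * (real_of_int i / real m) = of_int (2 * n) * pi"
      by (auto simp: z_def expi2pi_def exp_eq_1)
    then have "real_of_int i = real_of_int (n * int m)"
      using assms by (simp add: field_simps)
    then show False using False by (metis dvd_triv_right of_int_eq_iff)
  qed
  moreover have "z ^ m = 1"
    using assms expi2pi_of_int[of i] by (simp add: z_def expi2pi_power)
  ultimately have "(\<Sum>k<m. z ^ k) = 0" by (simp add: geometric_sum)
  moreover have "z ^ k = expi2pi (real_of_int i * real k / real m)" for k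
    by (simp add: z_def expi2pi_power mult_ac)
  ultimately show ?thesis using False by simp
qed

text \<open>Both signs occur: positive exponents in T_m S_m, negative ones in S_m T_m.\<close>

lemma sum_expi2pi_orthogonal:
  assumes "m > 0" "j < m"
  shows "(\<Sum>k<m. expi2pi (real j * real k / real m)) = (if j = 0 then of_nat m else 0)"
    and "(\<Sum>k<m. expi2pi (- (real j * real k / real m))) = (if j = 0 then of_nat m else 0)"
  using sum_expi2pi_roots[OF assms(1), of "int j"] sum_expi2pi_roots[OF assms(1), of "- int j"] assms(2)
  by (auto simp: nat_dvd_not_less)

section \<open>Twisted-periodic functions\<close>

lemma twisted_ext_add_of_nat_fst: "twisted_ext f (a + of_nat n) c = twisted_ext f a c"
proof (induction n)
  case (Suc n)
  then show ?case using twisted_ext_shift_fst[of f "a + of_nat n" c] by (simp add: add_ac)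
qed simp

lemma twisted_ext_add_of_int_fst: "twisted_ext f (a + of_int i) c = twisted_ext f a c"
proof (cases "i \<ge> 0")
  case True
  then show ?thesis using twisted_ext_add_of_nat_fst[of f a "nat i" c] by simp
next
  case False
  then show ?thesis using twisted_ext_add_of_nat_fst[of f "a + of_int i" "nat (- i)" c] by simp
qed

lemma twisted_ext_add_of_int_snd:
  "twisted_ext f a (c + of_int j) = expi2pi (- (a * of_int j)) * twisted_ext f a c"
proof -
  have "expi2pi (- (a * of_int \<lfloor>c + of_int j\<rfloor>)) =
      expi2pi (- (a * of_int j)) * expi2pi (- (a * of_int \<lfloor>c\<rfloor>))"
    by (simp add: expi2pi_add[symmetric] algebra_simps)
  then show ?thesis by (simp add: twisted_ext_def frac_def)
qed

text \<open>Representatives are functions on the whole plane, although their class depends only on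
  the square. This singles out those that obey the two relations everywhere, as the outputs of
  \<open>hecke_T\<close> and \<open>hecke_S\<close> do.\<close>

definition twisted_periodic :: "(real \<times> real \<Rightarrow> complex) \<Rightarrow> bool" where
  "twisted_periodic g \<longleftrightarrow>
     (\<forall>a c. g (a + 1, c) = g (a, c)) \<and> (\<forall>a c. g (a, c + 1) = expi2pi (- a) * g (a, c))"

text \<open>Iterating the two relations gives the effect of arbitrary integer shifts, and removing
  the integer parts of both coordinates reproduces the defining formula of
  \<open>twisted_ext\<close>. This eliminates the inner extension in composites of Hecke
  operators.\<close>

lemma twisted_ext_of_twisted_periodic:
  assumes "twisted_periodic g"
  shows "twisted_ext g a c = g (a, c)"
proof -
  have 1: "g (a + of_nat n, c) = g (a, c)" for a c n
  proof (induction n)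
    case (Suc n)
    have "g ((a + of_nat n) + 1, c) = g (a + of_nat n, c)"
      using assms by (simp add: twisted_periodic_def)
    then show ?case using Suc by (simp add: add_ac)
  qed simp
  have 2: "g (a, c + of_nat n) = expi2pi (- (a * of_nat n)) * g (a, c)" for a c n
  proof (induction n)
    case (Suc n)
    have "g (a, (c + of_nat n) + 1) = expi2pi (- a) * g (a, c + of_nat n)"
      using assms by (simp add: twisted_periodic_def)
    also have "\<dots> = expi2pi (- a + - (a * of_nat n)) * g (a, c)"
      by (simp add: Suc expi2pi_add[symmetric] mult.assoc[symmetric])
    finally show ?case by (simp add: algebra_simps)
  qed (use expi2pi_of_int[of 0] in simp)
  have 3: "g (a + of_int i, c) = g (a, c)" for a c i
    using 1[of a "nat i" c] 1[of "a + of_int i" "nat (- i)" c] by (cases "i \<ge> 0") simp_all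
  have 4: "g (a, c + of_int j) = expi2pi (- (a * of_int j)) * g (a, c)" for a c j
  proof (cases "j \<ge> 0")
    case True
    then show ?thesis using 2[of a c "nat j"] by simp
  next
    case False
    \<comment> \<open>A negative shift is a natural shift read backwards from the point
      \<open>c + of_int j\<close>; its phase is then moved to the other side.\<close>
    then have "g (a, c) = expi2pi (a * of_int j) * g (a, c + of_int j)"
      using 2[of a "c + of_int j" "nat (- j)"] by simp
    then have "expi2pi (- (a * of_int j)) * g (a, c) =
        expi2pi (- (a * of_int j) + a * of_int j) * g (a, c + of_int j)"
      by (simp only: expi2pi_add mult.assoc)
    then show ?thesis using expi2pi_of_int[of 0] by simp
  qed
  have "g (frac a, frac c) = g (a, frac c)"
    using 3[of "frac a" "\<lfloor>a\<rfloor>" "frac c"] by (simp add: frac_def)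
  moreover have "g (a, c) = expi2pi (- (a * of_int \<lfloor>c\<rfloor>)) * g (a, frac c)"
    using 4[of a "frac c" "\<lfloor>c\<rfloor>"] by (simp add: frac_def)
  ultimately show ?thesis by (simp add: twisted_ext_def)
qed

text \<open>Raising \<open>a\<close> by 1 permutes the sample points cyclically. Raising
  \<open>c\<close> by 1 moves the second argument by \<open>m\<close>, and the resulting phase at
  \<open>(a + k) / m\<close> is that of \<open>- a\<close> times the trivial phase of the integer
  \<open>- k\<close>.\<close>

lemma twisted_periodic_hecke_T:
  assumes "m \<ge> 1"
  shows "twisted_periodic (hecke_T m f)"
proof -
  let ?F = "twisted_ext f"
  have "hecke_T m f (a + 1, c) = hecke_T m f (a, c)" for a c
  proof -
    let ?g = "\<lambda>k. ?F ((a + real k) / real m) (real m * c)"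
    have "?g m = ?g 0"
      using twisted_ext_shift_fst[of f "a / real m" "real m * c"] assms
      by (simp add: add_divide_distrib)
    then have "(\<Sum>k<m. ?g (Suc k)) = (\<Sum>k<m. ?g k)" by (rule sum_cyclic_shift)
    then show ?thesis by (simp add: hecke_T_def atLeast0LessThan add_ac)
  qed
  moreover have "hecke_T m f (a, c + 1) = expi2pi (- a) * hecke_T m f (a, c)" for a c
  proof -
    have "?F ((a + real k) / real m) (real m * (c + 1)) =
        expi2pi (- a) * ?F ((a + real k) / real m) (real m * c)" for k
    proof -
      have "- ((a + real k) / real m * of_int (int m)) = - a + of_int (- int k)"
        using assms by (simp add: field_simps)
      then have "expi2pi (- ((a + real k) / real m * of_int (int m))) = expi2pi (- a + of_int (- int k))"
        by simp
      also have "\<dots> = expi2pi (- a)" by (simp only: expi2pi_add expi2pi_of_int mult_1_right)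
      finally show ?thesis
        using twisted_ext_add_of_int_snd[of f "(a + real k) / real m" "real m * c" "int m"]
        by (simp add: algebra_simps)
    qed
    then show ?thesis
      by (simp add: hecke_T_def sum_distrib_left[symmetric])
  qed
  ultimately show ?thesis by (simp add: twisted_periodic_def)
qed

text \<open>The roles of the variables are exchanged: \<open>a + 1\<close> changes only integer
  phases and shifts the first argument by \<open>m\<close>, while \<open>c + 1\<close> moves the
  index \<open>k\<close>, at the price of the factor between consecutive weights.\<close>

lemma twisted_periodic_hecke_S:
  assumes "m \<ge> 1"
  shows "twisted_periodic (hecke_S m f)"
proof -
  let ?F = "twisted_ext f"
  have "hecke_S m f (a + 1, c) = hecke_S m f (a, c)" for a c
  proof -
    have "expi2pi (real k * (a + 1)) = expi2pi (real k * a)" for k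
      using expi2pi_add[of "real k * a" "of_int (int k)"] expi2pi_of_int[of "int k"]
      by (simp add: algebra_simps)
    moreover have "?F (real m * (a + 1)) x = ?F (real m * a) x" for x
      using twisted_ext_add_of_int_fst[of f "real m * a" "int m" x] by (simp add: algebra_simps)
    ultimately show ?thesis by (simp add: hecke_S_def)
  qed
  moreover have "hecke_S m f (a, c + 1) = expi2pi (- a) * hecke_S m f (a, c)" for a c
  proof -
    let ?g = "\<lambda>k. expi2pi (real k * a) * ?F (real m * a) ((c + real k) / real m)"
    \<comment> \<open>The wrapped term \<open>k = m\<close> acquires the twist of a unit shift at
      first coordinate \<open>m * a\<close>, which cancels its weight.\<close>
    have "?g m = expi2pi (real m * a) * ?F (real m * a) (c / real m + 1)"
      using assms by (simp add: add_divide_distrib)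
    also have "\<dots> = expi2pi (real m * a + - (real m * a)) * ?F (real m * a) (c / real m)"
      by (simp only: twisted_ext_shift_snd expi2pi_add mult.assoc)
    also have "\<dots> = ?g 0" by simp
    finally have "(\<Sum>k<m. ?g (Suc k)) = (\<Sum>k<m. ?g k)" by (rule sum_cyclic_shift)
    moreover have "expi2pi (real k * a) * ?F (real m * a) ((c + 1 + real k) / real m) =
        expi2pi (- a) * ?g (Suc k)" for k
      by (simp add: mult.assoc[symmetric] expi2pi_add[symmetric] algebra_simps)
    ultimately show ?thesis
      by (simp add: hecke_S_def atLeast0LessThan sum_distrib_left[symmetric])
  qed
  ultimately show ?thesis by (simp add: twisted_periodic_def)
qed

text \<open>The second arguments differ by the integer \<open>1 - m\<close>. The twist of this shift
  cancels the weight up to the phase of the integer \<open>k\<close>, which is 1.\<close>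

lemma hecke_T_vee_eq: "m \<ge> 1 \<Longrightarrow> hecke_T_vee m f = hecke_T m f"
proof -
  assume m: "m \<ge> 1"
  have "expi2pi (((1 - real m) * a + real k) / real m) *
      twisted_ext f ((a + real k) / real m) (1 + real m * (c - 1)) =
      twisted_ext f ((a + real k) / real m) (real m * c)" for a c k
  proof -
    let ?x = "(a + real k) / real m"
    have "1 + real m * (c - 1) = real m * c + of_int (1 - int m)" by (simp add: algebra_simps)
    then have "expi2pi (((1 - real m) * a + real k) / real m) * twisted_ext f ?x (1 + real m * (c - 1)) =
        expi2pi (((1 - real m) * a + real k) / real m + - (?x * of_int (1 - int m))) *
        twisted_ext f ?x (real m * c)"
      by (simp only: twisted_ext_add_of_int_snd expi2pi_add mult.assoc)
    moreover have "((1 - real m) * a + real k) / real m + - (?x * of_int (1 - int m)) = of_int (int k)"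
      using m by (simp add: field_simps)
    ultimately show ?thesis by (simp only: expi2pi_of_int mult_1)
  qed
  then show ?thesis by (simp add: hecke_T_vee_def hecke_T_def)
qed

text \<open>The first arguments differ by the integer \<open>1 - m\<close>, which periodicity
  absorbs; what remains is the reversal \<open>k\<close> to \<open>m - 1 - k\<close> of the
  summation index.\<close>

lemma hecke_S_vee_eq: "hecke_S_vee m f = hecke_S m f"
proof -
  have "(\<Sum>k<m. expi2pi ((real m - (real k + 1)) * a) *
        twisted_ext f (1 + real m * (a - 1)) ((c + real m - (real k + 1)) / real m)) =
     (\<Sum>k<m. expi2pi (real k * a) * twisted_ext f (real m * a) ((c + real k) / real m))" for a c
  proof -
    have "twisted_ext f (1 + real m * (a - 1)) x = twisted_ext f (real m * a) x" for x
      using twisted_ext_add_of_int_fst[of f "real m * a" "1 - int m" x] by (simp add: algebra_simps)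
    then show ?thesis
      by (subst sum.nat_diff_reindex[symmetric]) (auto intro!: sum.cong simp: of_nat_diff algebra_simps)
  qed
  then show ?thesis by (simp add: hecke_S_vee_def hecke_S_def atLeast0LessThan)
qed

text \<open>Indices below \<open>m * n\<close> are written as \<open>k + j * m\<close> with
  \<open>k < m\<close> and \<open>j < n\<close>; this is the sample point reached by choosing
  \<open>k\<close> in the outer sum and \<open>j\<close> in the inner one.\<close>

lemma hecke_T_mult:
  assumes "m \<ge> 1" "n \<ge> 1"
  shows "hecke_T m (hecke_T n f) = hecke_T (m * n) f"
proof -
  let ?F = "twisted_ext f"
  have "hecke_T m (hecke_T n f) (a, c) = hecke_T (m * n) f (a, c)" for a c
  proof -
    let ?h = "\<lambda>i. ?F ((a + real i) / real (m * n)) (real (m * n) * c)"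
    have "(\<Sum>k<m. \<Sum>j<n. ?F (((a + real k) / real m + real j) / real n) (real n * (real m * c))) =
        (\<Sum>k<m. \<Sum>j<n. ?h (k + j * m))"
      using assms by (intro sum.cong refl) (simp add: field_simps)
    also have "\<dots> = (\<Sum>j<n. \<Sum>k<m. ?h (k + j * m))" by (rule sum.swap)
    also have "\<dots> = (\<Sum>j<n. sum ?h {j * m..<j * m + m})"
      by (subst sum.atLeastLessThan_shift_0) (simp add: atLeast0LessThan add.commute)
    also have "\<dots> = (\<Sum>i<n * m. ?h i)" by (rule sum.nat_group)
    finally show ?thesis
      unfolding hecke_T_def[of m] using assms
      by (simp add: twisted_ext_of_twisted_periodic[OF twisted_periodic_hecke_T])
        (simp add: hecke_T_def atLeast0LessThan sum_distrib_left[symmetric] mult_ac sum_divide_distrib[symmetric])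
  qed
  then show ?thesis by (auto simp: fun_eq_iff)
qed

text \<open>Periodicity removes \<open>k\<close> from the arguments of the extension, so
  \<open>k\<close> survives only in a root of unity and the sum over \<open>k\<close> isolates
  \<open>j = 0\<close>. The result is \<open>twisted_ext f\<close> because the computation is valid
  on the whole plane, where \<open>f\<close> itself carries no relations.\<close>

lemma hecke_T_S:
  assumes m: "m \<ge> 1"
  shows "hecke_T m (hecke_S m f) (a, c) = twisted_ext f a c / of_nat m"
proof -
  let ?F = "twisted_ext f"
  have 1: "expi2pi (real j * ((a + real k) / real m)) *
       ?F (real m * ((a + real k) / real m)) ((real m * c + real j) / real m) =
     expi2pi (real j * a / real m) * ?F a (c + real j / real m) * expi2pi (real j * real k / real m)"
     (is "?l k j = ?r j k") for j k
  proof -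
    have "real j * ((a + real k) / real m) = real j * a / real m + real j * real k / real m"
      by (simp add: distrib_left add_divide_distrib)
    moreover have "real m * ((a + real k) / real m) = a + of_int (int k)"
      "(real m * c + real j) / real m = c + real j / real m"
      using m by (auto simp: add_divide_distrib distrib_left)
    ultimately show ?thesis
      by (simp only: twisted_ext_add_of_int_fst expi2pi_add mult.assoc mult.commute mult.left_commute)
  qed
  have "(\<Sum>k<m. \<Sum>j<m. ?l k j) = (\<Sum>j<m. \<Sum>k<m. ?r j k)"
    unfolding 1 by (rule sum.swap)
  also have "\<dots> = (\<Sum>j<m. if j = 0 then of_nat m * ?F a c else 0)"
    unfolding sum_distrib_left[symmetric] using m
    by (intro sum.cong refl) (auto simp: sum_expi2pi_orthogonal expi2pi_of_int[of 0, simplified])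
  also have "\<dots> = of_nat m * ?F a c" using m by simp
  finally show ?thesis
    unfolding hecke_T_def using m
    by (simp add: twisted_ext_of_twisted_periodic[OF twisted_periodic_hecke_S])
      (simp add: hecke_S_def atLeast0LessThan sum_distrib_left[symmetric] sum_divide_distrib[symmetric])
qed

text \<open>Here \<open>k\<close> is an integer shift of the second variable at first coordinate
  \<open>a + j / m\<close>. Its twist cancels the weight \<open>expi2pi (real k * a)\<close> and
  leaves a root of unity in \<open>j * k\<close>.\<close>

lemma hecke_S_T:
  assumes m: "m \<ge> 1"
  shows "hecke_S m (hecke_T m f) (a, c) = twisted_ext f a c / of_nat m"
proof -
  let ?F = "twisted_ext f"
  have 1: "expi2pi (real k * a) * 
       ?F ((real m * a + real j) / real m) (real m * ((c + real k) / real m)) =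
     ?F (a + real j / real m) c * expi2pi (- (real j * real k / real m))"
     (is "?l k j = ?r j k") for j k
  proof -
    have "(real m * a + real j) / real m = a + real j / real m"
      "real m * ((c + real k) / real m) = c + of_int (int k)"
      using m by (auto simp: add_divide_distrib distrib_left)
    then have "?l k j = expi2pi (real k * a + - ((a + real j / real m) * of_int (int k))) *
        ?F (a + real j / real m) c"
      by (simp only: twisted_ext_add_of_int_snd expi2pi_add mult.assoc)
    moreover have "real k * a + - ((a + real j / real m) * of_int (int k)) = - (real j * real k / real m)"
      by (simp add: algebra_simps)
    ultimately show ?thesis by (simp only: mult.commute)
  qed
  have "(\<Sum>k<m. \<Sum>j<m. ?l k j) = (\<Sum>j<m. \<Sum>k<m. ?r j k)"
    unfolding 1 by (rule sum.swap)
  also have "\<dots> = (\<Sum>j<m. if j = 0 then of_nat m * ?F a c else 0)"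
    unfolding sum_distrib_left[symmetric] using m
    by (intro sum.cong refl) (auto simp: sum_expi2pi_orthogonal)
  also have "\<dots> = of_nat m * ?F a c" using m by simp
  finally show ?thesis
    unfolding hecke_S_def using m
    by (simp add: twisted_ext_of_twisted_periodic[OF twisted_periodic_hecke_T])
      (simp add: hecke_T_def atLeast0LessThan sum_distrib_left[symmetric] sum_divide_distrib[symmetric])
qed

section \<open>Affine maps and the unit square\<close>

text \<open>The coordinates are never mixed, so diagonal maps suffice: they cover the arguments in
  all summands, the integer translations, and the maps from the square onto its strips.\<close>

definition axis_affine :: "real \<Rightarrow> real \<Rightarrow> real \<Rightarrow> real \<Rightarrow> real \<times> real \<Rightarrow> real \<times> real" where
  "axis_affine \<alpha> \<beta> \<gamma> \<delta> = (\<lambda>x. (\<alpha> * fst x + \<beta>, \<gamma> * snd x + \<delta>))"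

lemma lebesgue_axis_affine:
  assumes "\<alpha> \<noteq> 0" "\<gamma> \<noteq> 0"
  shows lebesgue_eq_density_axis_affine:
      "lebesgue = density (distr lebesgue lebesgue (axis_affine \<alpha> \<beta> \<gamma> \<delta>)) (\<lambda>_. ennreal \<bar>\<alpha> * \<gamma>\<bar>)"
    and measurable_axis_affine: "axis_affine \<alpha> \<beta> \<gamma> \<delta> \<in> lebesgue \<rightarrow>\<^sub>M lebesgue"
proof -
  \<comment> \<open>\<open>s\<close> assigns the slope \<alpha> to the basis vector
    \<open>(1, 0)\<close> and \<gamma> to \<open>(0, 1)\<close>, the form in which the general
    change of variables takes its scaling factors.\<close>
  define s :: "real \<times> real \<Rightarrow> real" where "s b = fst b * \<alpha> + snd b * \<gamma>" for b
  have B: "(Basis :: (real \<times> real) set) = {(1, 0), (0, 1)}"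
    by (auto simp: Basis_prod_def)
  have T: "(\<lambda>x. (\<beta>, \<delta>) + (\<Sum>j\<in>Basis. (s j * (x \<bullet> j)) *\<^sub>R j)) = axis_affine \<alpha> \<beta> \<gamma> \<delta>"
    by (auto simp: B s_def axis_affine_def fun_eq_iff)
  have s: "s j \<noteq> 0" if "j \<in> Basis" for j
    using that assms by (auto simp: B s_def)
  have "(\<Prod>j\<in>Basis. ennreal \<bar>s j\<bar>) = ennreal \<bar>\<alpha> * \<gamma>\<bar>"
    by (simp add: B s_def abs_mult ennreal_mult)
  then show "lebesgue = density (distr lebesgue lebesgue (axis_affine \<alpha> \<beta> \<gamma> \<delta>)) (\<lambda>_. ennreal \<bar>\<alpha> * \<gamma>\<bar>)"
    using lebesgue_affine_euclidean[of s "(\<beta>, \<delta>)", OF s] by (simp add: T prod_ennreal)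
  show "axis_affine \<alpha> \<beta> \<gamma> \<delta> \<in> lebesgue \<rightarrow>\<^sub>M lebesgue"
    using lebesgue_affine_measurable[of s "(\<beta>, \<delta>)", OF s] by (simp add: T)
qed

lemma AE_axis_affine:
  assumes "\<alpha> \<noteq> 0" "\<gamma> \<noteq> 0" "AE x in lebesgue. P x"
  shows "AE x in lebesgue. P (axis_affine \<alpha> \<beta> \<gamma> \<delta> x)"
proof -
  have "AE x in density (distr lebesgue lebesgue (axis_affine \<alpha> \<beta> \<gamma> \<delta>)) (\<lambda>_. ennreal \<bar>\<alpha> * \<gamma>\<bar>). P x"
    using assms(3) by (simp only: lebesgue_eq_density_axis_affine[OF assms(1,2), symmetric])
  then have "AE x in distr lebesgue lebesgue (axis_affine \<alpha> \<beta> \<gamma> \<delta>). P x"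
    using assms by (subst (asm) AE_density) auto
  then show ?thesis
    by (rule AE_distrD[OF measurable_axis_affine[OF assms(1,2)]])
qed

lemma nn_integral_axis_affine:
  assumes "\<alpha> \<noteq> 0" "\<gamma> \<noteq> 0" and f: "f \<in> borel_measurable lebesgue"
  shows "(\<integral>\<^sup>+x. f (axis_affine \<alpha> \<beta> \<gamma> \<delta> x) \<partial>lebesgue) = ennreal (1 / \<bar>\<alpha> * \<gamma>\<bar>) * (\<integral>\<^sup>+x. f x \<partial>lebesgue)"
proof -
  note T = measurable_axis_affine[OF assms(1,2), of \<beta> \<delta>]
  have "(\<integral>\<^sup>+x. f x \<partial>lebesgue) = (\<integral>\<^sup>+x. f x \<partial>density (distr lebesgue lebesgue (axis_affine \<alpha> \<beta> \<gamma> \<delta>)) (\<lambda>_. ennreal \<bar>\<alpha> * \<gamma>\<bar>))"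
    using lebesgue_eq_density_axis_affine[OF assms(1,2), of \<beta> \<delta>] by simp
  also have "\<dots> = (\<integral>\<^sup>+x. ennreal \<bar>\<alpha> * \<gamma>\<bar> * f x \<partial>distr lebesgue lebesgue (axis_affine \<alpha> \<beta> \<gamma> \<delta>))"
    using f by (intro nn_integral_density) auto
  also have "\<dots> = (\<integral>\<^sup>+x. ennreal \<bar>\<alpha> * \<gamma>\<bar> * f (axis_affine \<alpha> \<beta> \<gamma> \<delta> x) \<partial>lebesgue)"
    using f T by (intro nn_integral_distr) auto
  also have "\<dots> = ennreal \<bar>\<alpha> * \<gamma>\<bar> * (\<integral>\<^sup>+x. f (axis_affine \<alpha> \<beta> \<gamma> \<delta> x) \<partial>lebesgue)"
    using f T by (intro nn_integral_cmult) (auto intro: measurable_compose)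
  finally show ?thesis
    using assms(1,2) by (simp add: mult.assoc[symmetric] ennreal_mult[symmetric])
qed

lemma integral_axis_affine:
  fixes f :: "real \<times> real \<Rightarrow> 'a::{banach, second_countable_topology}"
  assumes "\<alpha> \<noteq> 0" "\<gamma> \<noteq> 0" and f: "f \<in> borel_measurable lebesgue"
  shows "(LINT x|lebesgue. f (axis_affine \<alpha> \<beta> \<gamma> \<delta> x)) = (1 / \<bar>\<alpha> * \<gamma>\<bar>) *\<^sub>R (LINT x|lebesgue. f x)"
proof -
  note T = measurable_axis_affine[OF assms(1,2), of \<beta> \<delta>]
  have "(LINT x|lebesgue. f x) = (LINT x|density (distr lebesgue lebesgue (axis_affine \<alpha> \<beta> \<gamma> \<delta>)) (\<lambda>_. ennreal \<bar>\<alpha> * \<gamma>\<bar>). f x)"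
    using lebesgue_eq_density_axis_affine[OF assms(1,2), of \<beta> \<delta>] by simp
  also have "\<dots> = (LINT x|distr lebesgue lebesgue (axis_affine \<alpha> \<beta> \<gamma> \<delta>). \<bar>\<alpha> * \<gamma>\<bar> *\<^sub>R f x)"
    using f by (intro integral_density) auto
  also have "\<dots> = (LINT x|lebesgue. \<bar>\<alpha> * \<gamma>\<bar> *\<^sub>R f (axis_affine \<alpha> \<beta> \<gamma> \<delta> x))"
    using f T by (intro integral_distr) auto
  finally show ?thesis
    using assms(1,2) by simp
qed

section \<open>Integration over the unit square\<close>

lemma sets_lebesgue_Times_real:
  fixes A B :: "real set"
  assumes "A \<in> sets borel" "B \<in> sets borel"
  shows "A \<times> B \<in> sets lebesgue"
proof -
  have "A \<times> B \<in> sets (borel \<Otimes>\<^sub>M borel)" using assms by auto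
  then show ?thesis by (metis borel_prod sets_completionI_sets sets_lborel)
qed

lemma AE_box_measure_iff:
  "(AE x in box_measure. P x) \<longleftrightarrow> (AE x in lebesgue. x \<in> {0..1} \<times> {0..1} \<longrightarrow> P x)"
  unfolding box_measure_def
  by (rule AE_restrict_space_iff) (simp add: sets_lebesgue_Times_real)

lemma borel_measurable_box_measure:
  "f \<in> lebesgue \<rightarrow>\<^sub>M N \<Longrightarrow> f \<in> box_measure \<rightarrow>\<^sub>M N"
  unfolding box_measure_def by (rule measurable_restrict_space1)

text \<open>Translates of the half-open square tile the plane without overlap, whereas
  \<open>box_measure\<close> lives on the closed one; the difference lies on two null lines.\<close>

lemma AE_lebesgue_box_iff_half_open:
  "AE x in lebesgue. x \<in> {0..1::real} \<times> {0..1::real} \<longleftrightarrow> x \<in> {0..<1} \<times> {0..<1}"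
proof -
  have "negligible {x :: real \<times> real. x \<bullet> b = 1}" if "b \<in> Basis" for b
    using negligible_standard_hyperplane[OF that, of 1] by simp
  from this[of "(1, 0)"] this[of "(0, 1)"]
  have "negligible {x :: real \<times> real. fst x = 1}" "negligible {x :: real \<times> real. snd x = 1}"
    by (auto simp: Basis_prod_def inner_prod_def)
  then have "AE x :: real \<times> real in lebesgue. fst x \<noteq> 1" "AE x :: real \<times> real in lebesgue. snd x \<noteq> 1"
    by (auto simp: negligible_iff_null_sets dest!: AE_not_in)
  then show ?thesis
    by eventually_elim (auto simp: less_le)
qed

lemma nn_integral_box_measure:
  "(\<integral>\<^sup>+x. h x \<partial>box_measure) = (\<integral>\<^sup>+x. h x * indicator ({0..<1} \<times> {0..<1}) x \<partial>lebesgue)"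
proof -
  have "(\<integral>\<^sup>+x. h x \<partial>box_measure) = (\<integral>\<^sup>+x. h x * indicator ({0..1} \<times> {0..1}) x \<partial>lebesgue)"
    unfolding box_measure_def
    by (rule nn_integral_restrict_space) (simp add: sets_lebesgue_Times_real)
  also have "\<dots> = (\<integral>\<^sup>+x. h x * indicator ({0..<1} \<times> {0..<1}) x \<partial>lebesgue)"
    using AE_lebesgue_box_iff_half_open
    by (intro nn_integral_cong_AE, eventually_elim) (simp add: indicator_def)
  finally show ?thesis .
qed

lemma integral_box_measure:
  fixes h :: "real \<times> real \<Rightarrow> 'a::{banach, second_countable_topology}"
  assumes [measurable]: "h \<in> borel_measurable lebesgue"
  shows "(LINT x|box_measure. h x) = (LINT x|lebesgue. indicator ({0..<1} \<times> {0..<1}) x *\<^sub>R h x)"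
proof -
  have [measurable]: "{0..<1} \<times> {0..<1} \<in> sets (lebesgue :: (real \<times> real) measure)"
    "{0..1} \<times> {0..1} \<in> sets (lebesgue :: (real \<times> real) measure)"
    by (simp_all add: sets_lebesgue_Times_real)
  have "(LINT x|box_measure. h x) = (LINT x|lebesgue. indicator ({0..1} \<times> {0..1}) x *\<^sub>R h x)"
    unfolding box_measure_def by (rule integral_restrict_space) simp
  also have "\<dots> = (LINT x|lebesgue. indicator ({0..<1} \<times> {0..<1}) x *\<^sub>R h x)"
    using AE_lebesgue_box_iff_half_open
    by (intro integral_cong_AE) (auto elim!: eventually_mono simp: indicator_def)
  finally show ?thesis .
qed

lemma integrable_box_measure_iff:
  fixes h :: "real \<times> real \<Rightarrow> 'a::{banach, second_countable_topology}"
  assumes [measurable]: "h \<in> borel_measurable lebesgue"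
  shows "integrable box_measure h \<longleftrightarrow>
     integrable lebesgue (\<lambda>x. indicator ({0..<1} \<times> {0..<1}) x *\<^sub>R h x)"
proof -
  have [measurable]: "{0..<1} \<times> {0..<1} \<in> sets (lebesgue :: (real \<times> real) measure)"
    "{0..1} \<times> {0..1} \<in> sets (lebesgue :: (real \<times> real) measure)"
    by (simp_all add: sets_lebesgue_Times_real)
  have "integrable box_measure h \<longleftrightarrow> integrable lebesgue (\<lambda>x. indicator ({0..1} \<times> {0..1}) x *\<^sub>R h x)"
    unfolding box_measure_def by (rule integrable_restrict_space) simp
  also have "\<dots> \<longleftrightarrow> integrable lebesgue (\<lambda>x. indicator ({0..<1} \<times> {0..<1}) x *\<^sub>R h x)"
    using AE_lebesgue_box_iff_half_open
    by (intro integrable_cong_AE) (auto elim!: eventually_mono simp: indicator_def)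
  finally show ?thesis .
qed

section \<open>From the square to the plane: null sets, measurability and integrals\<close>

lemma borel_measurable_lebesgue_fst_snd [measurable]:
  "(fst :: real \<times> real \<Rightarrow> real) \<in> borel_measurable lebesgue"
  "(snd :: real \<times> real \<Rightarrow> real) \<in> borel_measurable lebesgue"
  by (intro measurable_completion; simp add: borel_prod[symmetric])+

text \<open>At each point, taking fractional parts agrees with one of countably many integer
  translations. Each of these preserves almost everywhere statements, and a countable conjunction of
  them is still one.\<close>

lemma AE_lebesgue_frac:
  assumes "AE x in box_measure. P x"
  shows "AE x in lebesgue. P (frac (fst x), frac (snd x))"
proof -
  have "AE x in lebesgue. x \<in> {0..1} \<times> {0..1} \<longrightarrow> P x"
    using assms by (simp add: AE_box_measure_iff)
  then have "AE x in lebesgue. axis_affine 1 (- of_int i) 1 (- of_int j) x \<in> {0..1} \<times> {0..1} \<longrightarrow>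
      P (axis_affine 1 (- of_int i) 1 (- of_int j) x)" for i j :: int
    by (intro AE_axis_affine) auto
  then have "AE x in lebesgue. \<forall>i j :: int. axis_affine 1 (- of_int i) 1 (- of_int j) x \<in> {0..1} \<times> {0..1} \<longrightarrow>
      P (axis_affine 1 (- of_int i) 1 (- of_int j) x)"
    by (simp add: AE_all_countable)
  then show ?thesis
  proof eventually_elim
    case (elim x)
    have "axis_affine 1 (- of_int \<lfloor>fst x\<rfloor>) 1 (- of_int \<lfloor>snd x\<rfloor>) x = (frac (fst x), frac (snd x))"
      by (simp add: axis_affine_def frac_def)
    moreover have "(frac (fst x), frac (snd x)) \<in> {0..1} \<times> {0..1}"
      by (simp add: less_imp_le[OF frac_lt_1])
    ultimately show ?case using elim by metis
  qed
qed

text \<open>On the set where both floors have given values the extension is a continuous phase times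
  a translate of \<open>f\<close>; countably many such pieces are glued along the measurable
  floors.\<close>

lemma borel_measurable_twisted_ext:
  assumes "f \<in> borel_measurable box_measure"
  shows "(\<lambda>x. twisted_ext f (fst x) (snd x)) \<in> borel_measurable lebesgue"
proof -
  \<comment> \<open>Measurability of \<open>f\<close> is known on the square only, so
    \<open>f\<close> is cut off to 0 outside it.\<close>
  define g where "g x = (if x \<in> {0..1} \<times> {0..1} then f x else 0)" for x
  have g: "g \<in> borel_measurable lebesgue"
    using assms unfolding g_def box_measure_def
    by (intro borel_measurable_if_I) (simp_all add: sets_lebesgue_Times_real)
  have 1: "(\<lambda>x. expi2pi (- (fst x * of_int j)) * g (axis_affine 1 (- of_int i) 1 (- of_int j) x))
      \<in> borel_measurable lebesgue" for i j :: int
  proof (rule borel_measurable_times)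
    have "continuous_on UNIV (\<lambda>x :: real \<times> real. expi2pi (- (fst x * of_int j)))"
      unfolding expi2pi_def by (intro continuous_intros)
    then show "(\<lambda>x :: real \<times> real. expi2pi (- (fst x * of_int j))) \<in> borel_measurable lebesgue"
      by (intro measurable_completion) (simp add: borel_measurable_continuous_onI)
    show "(\<lambda>x. g (axis_affine 1 (- of_int i) 1 (- of_int j) x)) \<in> borel_measurable lebesgue"
      by (rule measurable_compose[OF measurable_axis_affine g]) auto
  qed
  have fl: "(\<lambda>x. \<lfloor>fst x\<rfloor>) \<in> (lebesgue :: (real \<times> real) measure) \<rightarrow>\<^sub>M count_space UNIV"
      "(\<lambda>x. \<lfloor>snd x\<rfloor>) \<in> (lebesgue :: (real \<times> real) measure) \<rightarrow>\<^sub>M count_space UNIV"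
    by (rule measurable_compose[OF borel_measurable_lebesgue_fst_snd(1) measurable_real_floor]
        measurable_compose[OF borel_measurable_lebesgue_fst_snd(2) measurable_real_floor])+
  have "(\<lambda>x. expi2pi (- (fst x * of_int \<lfloor>snd x\<rfloor>)) *
      g (axis_affine 1 (- of_int \<lfloor>fst x\<rfloor>) 1 (- of_int \<lfloor>snd x\<rfloor>) x)) \<in> borel_measurable lebesgue"
    by (rule measurable_compose_countable[OF measurable_compose_countable[OF 1 fl(1)] fl(2)])
  moreover have "g (axis_affine 1 (- of_int \<lfloor>fst x\<rfloor>) 1 (- of_int \<lfloor>snd x\<rfloor>) x) =
      f (frac (fst x), frac (snd x))" for x
    by (simp add: g_def axis_affine_def frac_def[symmetric] less_imp_le[OF frac_lt_1])
  ultimately show ?thesis by (simp add: twisted_ext_def)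
qed

text \<open>The image of the square is covered by finitely many unit cells, and over each of them a
  periodic function has the same integral as over the square. The constant is obtained before
  \<open>h\<close>, which makes it uniform and hence usable as an operator bound.\<close>

lemma nn_integral_box_periodic_affine_le:
  assumes "\<alpha> \<noteq> 0" "\<gamma> \<noteq> 0"
  obtains C :: real where "C \<ge> 0"
    "\<And>h :: real \<times> real \<Rightarrow> ennreal. \<lbrakk>h \<in> borel_measurable lebesgue;
        \<And>a c i j. h (a + of_int i, c + of_int j) = h (a, c)\<rbrakk> \<Longrightarrow>
        (\<integral>\<^sup>+x. h (axis_affine \<alpha> \<beta> \<gamma> \<delta> x) \<partial>box_measure) \<le> ennreal C * (\<integral>\<^sup>+x. h x \<partial>box_measure)"
proof -
  let ?Q = "{0..<1::real} \<times> {0..<1::real}"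
  let ?\<phi> = "axis_affine \<alpha> \<beta> \<gamma> \<delta>"
  \<comment> \<open>\<open>N\<close> bounds both coordinates on the image of the half-open square,
    so the cells of \<open>I\<close> cover that image.\<close>
  obtain N :: nat where N: "real N \<ge> \<bar>\<alpha>\<bar> + \<bar>\<beta>\<bar> + \<bar>\<gamma>\<bar> + \<bar>\<delta>\<bar>"
    using real_arch_simple by blast
  define I where "I = {- int N..int N} \<times> {- int N..int N}"
  have finI: "finite I" by (simp add: I_def)
  have [measurable]: "?Q \<in> sets lebesgue" by (simp add: sets_lebesgue_Times_real)
  show ?thesis
  \<comment> \<open>The constant is the number of cells in \<open>I\<close> times the Jacobian
    factor of the substitution.\<close>
  proof (rule that[of "real (card I) / \<bar>\<alpha> * \<gamma>\<bar>"])
    fix h :: "real \<times> real \<Rightarrow> ennreal"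
    assume h[measurable]: "h \<in> borel_measurable lebesgue"
      and per: "\<And>a c i j. h (a + of_int i, c + of_int j) = h (a, c)"
    define sh where "sh = (\<lambda>(i, j). axis_affine 1 (- of_int i) 1 (- of_int j))"
    have sh[measurable]: "sh ij \<in> lebesgue \<rightarrow>\<^sub>M lebesgue" for ij
      by (cases ij) (simp add: sh_def measurable_axis_affine)
    \<comment> \<open>By periodicity this is \<open>h\<close> restricted to the cell with lower left
      corner \<open>ij\<close>: \<open>sh ij\<close> translates that cell back to the
      square.\<close>
    define g where "g ij y = h (sh ij y) * indicator ?Q (sh ij y)" for ij y
    have g[measurable]: "g ij \<in> borel_measurable lebesgue" for ij
      unfolding g_def by measurable
    have hsh: "h (sh ij y) = h y" for ij y
      using per[of "fst y" "- fst ij" "snd y" "- snd ij"]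
      by (simp add: sh_def axis_affine_def case_prod_beta)
    have le: "h (?\<phi> x) * indicator ?Q x \<le> (\<Sum>ij\<in>I. g ij (?\<phi> x))" for x
    proof (cases "x \<in> ?Q")
      case True
      define y where "y = ?\<phi> x"
      have bd: "\<bar>u * s + v\<bar> \<le> real N" if "\<bar>u\<bar> + \<bar>v\<bar> \<le> real N" "0 \<le> s" "s < 1" for u s v :: real
      proof -
        have "\<bar>u * s\<bar> \<le> \<bar>u\<bar> * 1" unfolding abs_mult using that by (intro mult_left_mono) auto
        then show ?thesis using that by linarith
      qed
      have "\<bar>fst y\<bar> \<le> real N" "\<bar>snd y\<bar> \<le> real N"
        using True N by (auto simp: y_def axis_affine_def intro!: bd)
      then have "(\<lfloor>fst y\<rfloor>, \<lfloor>snd y\<rfloor>) \<in> I"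
        unfolding I_def by (simp add: le_floor_iff floor_le_iff) linarith
      moreover have "g (\<lfloor>fst y\<rfloor>, \<lfloor>snd y\<rfloor>) y = h y"
        by (simp add: g_def hsh) (simp add: sh_def axis_affine_def indicator_def frac_def[symmetric] frac_lt_1)
      ultimately have "h y \<le> (\<Sum>ij\<in>I. g ij y)"
        using finI member_le_sum[of "(\<lfloor>fst y\<rfloor>, \<lfloor>snd y\<rfloor>)" I "\<lambda>ij. g ij y"] by simp
      then show ?thesis using True by (simp add: y_def)
    qed simp
    have "(\<integral>\<^sup>+x. h (?\<phi> x) \<partial>box_measure) \<le> (\<integral>\<^sup>+x. (\<Sum>ij\<in>I. g ij (?\<phi> x)) \<partial>lebesgue)"
      unfolding nn_integral_box_measure using le by (rule nn_integral_mono)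
    also have "\<dots> = (\<Sum>ij\<in>I. \<integral>\<^sup>+x. g ij (?\<phi> x) \<partial>lebesgue)"
      by (intro nn_integral_sum measurable_compose[OF measurable_axis_affine g] assms)
    also have "\<dots> = (\<Sum>ij\<in>I. ennreal (1 / \<bar>\<alpha> * \<gamma>\<bar>) * (\<integral>\<^sup>+x. g ij x \<partial>lebesgue))"
      by (intro sum.cong refl nn_integral_axis_affine assms g)
    also have "\<dots> = (\<Sum>ij\<in>I. ennreal (1 / \<bar>\<alpha> * \<gamma>\<bar>) * (\<integral>\<^sup>+x. h x \<partial>box_measure))"
    proof (intro sum.cong refl arg_cong2[where f = "(*)"])
      fix ij :: "int \<times> int"
      have "(\<lambda>x. h x * indicator ?Q x) \<in> borel_measurable lebesgue" by measurable
      from nn_integral_axis_affine[OF _ _ this, of 1 1 "- of_int (fst ij)" "- of_int (snd ij)"]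
      show "(\<integral>\<^sup>+x. g ij x \<partial>lebesgue) = (\<integral>\<^sup>+x. h x \<partial>box_measure)"
        by (simp add: g_def sh_def nn_integral_box_measure case_prod_beta)
    qed
    also have "\<dots> = ennreal (real (card I) / \<bar>\<alpha> * \<gamma>\<bar>) * (\<integral>\<^sup>+x. h x \<partial>box_measure)"
      by (simp add: mult.assoc[symmetric] ennreal_of_nat_eq_real_of_nat ennreal_mult[symmetric])
    finally show "(\<integral>\<^sup>+x. h (?\<phi> x) \<partial>box_measure) \<le> \<dots>" .
  qed simp
qed

text \<open>Each substitution maps the square onto one of \<open>m\<close> strips with Jacobian
  \<open>1 / m\<close>, so averaging over \<open>k\<close> adds up the integrals over a partition of
  the square.\<close>

lemma integral_box_average:
  fixes P :: "real \<times> real \<Rightarrow> complex"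
  assumes m: "m \<ge> 1" and P: "P \<in> borel_measurable lebesgue" and int: "integrable box_measure P"
  shows "1 / of_nat m * (\<Sum>k<m. LINT x|box_measure. P ((fst x + real k) / real m, snd x)) =
      (LINT x|box_measure. P x)" (is ?fst)
    and "1 / of_nat m * (\<Sum>k<m. LINT x|box_measure. P (fst x, (snd x + real k) / real m)) =
      (LINT x|box_measure. P x)" (is ?snd)
proof -
  let ?Q = "{0..<1::real} \<times> {0..<1::real}"
  let ?J = "\<lambda>k. {real k / real m..<(real k + 1) / real m}"
  have [measurable]: "?Q \<in> sets lebesgue" by (simp add: sets_lebesgue_Times_real)
  note P[measurable]
  \<comment> \<open>The intervals are half-open, so every \<open>t\<close> in the unit interval lies
    in exactly one of them, the one of index floor of \<open>t * m\<close>.\<close>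
  have J: "(\<Sum>k<m. indicator (?J k) t) = (indicator {0..<1} t :: real)" for t
  proof (cases "t \<in> {0..<1}")
    case True
    define k where "k = nat \<lfloor>t * real m\<rfloor>"
    have "t \<in> ?J i \<longleftrightarrow> i = k" for i
    proof -
      have "t \<in> ?J i \<longleftrightarrow> real i \<le> t * real m \<and> t * real m < real i + 1"
        using m by (simp add: field_simps)
      also have "\<dots> \<longleftrightarrow> \<lfloor>t * real m\<rfloor> = int i" by (simp add: floor_eq_iff)
      also have "\<dots> \<longleftrightarrow> i = k" using True by (auto simp: k_def)
      finally show ?thesis .
    qed
    moreover have "k < m"
    proof -
      have "t * real m < real m" using True m by simp
      then have "\<lfloor>t * real m\<rfloor> < int m" by (simp add: floor_less_iff)
      then show ?thesis using m by (simp add: k_def nat_less_iff)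
    qed
    ultimately show ?thesis using True by (simp add: indicator_def sum.If_cases)
  next
    case False
    have "t \<notin> ?J k" if "k < m" for k
    proof
      assume t: "t \<in> ?J k"
      have "(real k + 1) / real m \<le> 1" using that m by (simp add: field_simps)
      moreover have "0 \<le> real k / real m" by simp
      moreover have "real k / real m \<le> t" "t < (real k + 1) / real m" "t < 0 \<or> 1 \<le> t"
        using t False by auto
      ultimately show False by linarith
    qed
    then have "(\<Sum>k<m. indicator (?J k) t) = (0 :: real)" by (intro sum.neutral) simp
    then show ?thesis using False by simp
  qed
  \<comment> \<open>Common form of both cuttings: the regions \<open>R k\<close> are described only
    by their indicators adding up to that of the square and by the affine maps carrying the square
    onto them.\<close>
  have main: "1 / of_nat m * (\<Sum>k<m. LINT x|box_measure. P (axis_affine \<alpha> (\<beta> k) \<gamma> (\<delta> k) x)) =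
      (LINT x|box_measure. P x)"
    if nz: "\<alpha> \<noteq> 0" "\<gamma> \<noteq> 0" and ag: "\<bar>\<alpha> * \<gamma>\<bar> = 1 / real m"
      and R: "\<And>k. R k \<in> sets lebesgue"
      and Q: "\<And>k x. x \<in> ?Q \<longleftrightarrow> axis_affine \<alpha> (\<beta> k) \<gamma> (\<delta> k) x \<in> R k"
      and sR: "\<And>x. (\<Sum>k<m. indicator (R k) x) = (indicator ?Q x :: real)"
    for \<alpha> \<gamma> and \<beta> \<delta> :: "nat \<Rightarrow> real" and R :: "nat \<Rightarrow> (real \<times> real) set"
  proof -
    note R[measurable]
    \<comment> \<open>Nonnegative indicators that sum to the indicator of the square force
      \<open>R k\<close> to lie inside it, and only there is \<open>P\<close> known to be
      integrable.\<close>
    have RQ: "indicator (R k) x = indicator (R k) x * (indicator ?Q x :: real)" if "k < m" for k x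
    proof (cases "x \<in> R k")
      case True
      have "0 < (\<Sum>k<m. indicator (R k) x :: real)"
        using True that by (intro sum_pos2[of _ k]) auto
      then show ?thesis unfolding sR by (auto simp: indicator_def split: if_splits)
    qed simp
    have intR: "integrable lebesgue (\<lambda>x. indicator (R k) x *\<^sub>R P x)" if "k < m" for k
    proof -
      have "integrable lebesgue (\<lambda>x. indicator (R k) x *\<^sub>R indicator ?Q x *\<^sub>R P x)"
        using int integrable_box_measure_iff[OF P] by (subst integrable_mult_indicator[OF R]) simp_all
      then show ?thesis using RQ[OF that] by simp
    qed
    have "(LINT x|box_measure. P (axis_affine \<alpha> (\<beta> k) \<gamma> (\<delta> k) x)) =
        real m *\<^sub>R (LINT x|lebesgue. indicator (R k) x *\<^sub>R P x)" for k
    proof -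
      have "(LINT x|box_measure. P (axis_affine \<alpha> (\<beta> k) \<gamma> (\<delta> k) x)) =
          (LINT x|lebesgue. (\<lambda>y. indicator (R k) y *\<^sub>R P y) (axis_affine \<alpha> (\<beta> k) \<gamma> (\<delta> k) x))"
        unfolding integral_box_measure[OF measurable_compose[OF measurable_axis_affine[OF nz] P]]
        by (intro Bochner_Integration.integral_cong refl) (simp add: indicator_def Q[of _ k] del: mem_Times_iff)
      also have "\<dots> = real m *\<^sub>R (LINT x|lebesgue. indicator (R k) x *\<^sub>R P x)"
        using nz by (subst integral_axis_affine) (auto simp: ag)
      finally show ?thesis .
    qed
    then have "1 / of_nat m * (\<Sum>k<m. LINT x|box_measure. P (axis_affine \<alpha> (\<beta> k) \<gamma> (\<delta> k) x)) =
        (\<Sum>k<m. LINT x|lebesgue. indicator (R k) x *\<^sub>R P x)"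
      using m by (simp add: scaleR_conv_of_real sum_distrib_left[symmetric])
    also have "\<dots> = (LINT x|lebesgue. (\<Sum>k<m. indicator (R k) x *\<^sub>R P x))"
      using intR by (intro Bochner_Integration.integral_sum[symmetric]) auto
    also have "\<dots> = (LINT x|box_measure. P x)"
      by (simp add: scaleR_sum_left[symmetric] sR integral_box_measure P)
    finally show ?thesis .
  qed
  have "1 / of_nat m * (\<Sum>k<m. LINT x|box_measure. P (axis_affine (1 / real m) (real k / real m) 1 0 x)) =
      (LINT x|box_measure. P x)"
  proof (rule main[where R = "\<lambda>k. ?J k \<times> {0..<1}"])
    show "(\<Sum>k<m. indicator (?J k \<times> {0..<1}) x) = (indicator ?Q x :: real)" for x :: "real \<times> real"
      using J[of "fst x"] by (cases x) (simp add: indicator_times sum_distrib_right[symmetric])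
    show "x \<in> ?Q \<longleftrightarrow> axis_affine (1 / real m) (real k / real m) 1 0 x \<in> ?J k \<times> {0..<1}" for k x
      using m by (cases x) (auto simp: axis_affine_def field_simps)
  qed (use m in \<open>auto intro!: sets_lebesgue_Times_real\<close>)
  then show ?fst by (simp add: axis_affine_def add_divide_distrib)
  have "1 / of_nat m * (\<Sum>k<m. LINT x|box_measure. P (axis_affine 1 0 (1 / real m) (real k / real m) x)) =
      (LINT x|box_measure. P x)"
  proof (rule main[where R = "\<lambda>k. {0..<1} \<times> ?J k"])
    show "(\<Sum>k<m. indicator ({0..<1} \<times> ?J k) x) = (indicator ?Q x :: real)" for x :: "real \<times> real"
      using J[of "snd x"] by (cases x) (simp add: indicator_times sum_distrib_left[symmetric])
    show "x \<in> ?Q \<longleftrightarrow> axis_affine 1 0 (1 / real m) (real k / real m) x \<in> {0..<1} \<times> ?J k" for k x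
      using m by (cases x) (auto simp: axis_affine_def field_simps)
  qed (use m in \<open>auto intro!: sets_lebesgue_Times_real\<close>)
  then show ?snd by (simp add: axis_affine_def add_divide_distrib)
qed

section \<open>The quasi-normed spaces \<open>L\<^sup>p\<close>\<close>

lemma ae_class_eq_iff: "ae_class f = ae_class g \<longleftrightarrow> (AE x in box_measure. f x = g x)"
  by (rule ae_fun.abs_eq_iff)

lemma ae_class_ae_rep: "ae_class (ae_rep u) = u"
  by (rule Quotient_abs_rep[OF Quotient_ae_fun])

lemma ae_fun_cases: obtains f where "u = ae_class f"
  using ae_class_ae_rep[of u] by metis

lemma ae_class_in_Lp_iff:
  "ae_class f \<in> Lp p \<longleftrightarrow> f \<in> borel_measurable box_measure \<and>
     (if p = \<infinity> then esssup box_measure (\<lambda>x. ennreal (norm (f x))) < \<infinity>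
      else (\<integral>\<^sup>+x. ennreal (norm (f x) powr enn2real p) \<partial>box_measure) < \<infinity>)"
  by (simp add: Lp_def Lp_mem.abs_eq)

lemma enn2real_exponent_pos: "1 \<le> p \<Longrightarrow> p \<noteq> \<infinity> \<Longrightarrow> 0 < enn2real p"
  by (metis enn2real_positive_iff ennreal_zero_less_one infinity_ennreal_def less_le_trans top.not_eq_extremum)

lemma Lp_norm_nonneg: "0 \<le> Lp_norm p u"
  by transfer (simp add: enn2real_nonneg)

lemma Lp_dominated:
  assumes "p \<noteq> \<infinity>" and f: "ae_class f \<in> Lp p"
    and g: "g \<in> borel_measurable box_measure"
    and C: "0 \<le> C"
    and le: "(\<integral>\<^sup>+x. ennreal (norm (g x) powr enn2real p) \<partial>box_measure) \<le>
      ennreal C * (\<integral>\<^sup>+x. ennreal (norm (f x) powr enn2real p) \<partial>box_measure)"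
  shows "ae_class g \<in> Lp p" "Lp_norm p (ae_class g) \<le> C powr (1 / enn2real p) * Lp_norm p (ae_class f)"
proof -
  let ?I = "\<lambda>f. \<integral>\<^sup>+x. ennreal (norm (f x :: complex) powr enn2real p) \<partial>box_measure"
  have fin: "?I f < \<infinity>" using assms(1) f by (simp add: ae_class_in_Lp_iff)
  then have "ennreal C * ?I f < \<infinity>" by (simp add: ennreal_mult_less_top)
  then have fin': "?I g < \<infinity>" using le by (rule le_less_trans[rotated])
  then show "ae_class g \<in> Lp p" using assms(1) g by (simp add: ae_class_in_Lp_iff)
  have "enn2real (?I g) \<le> enn2real (ennreal C * ?I f)"
    using le fin by (intro enn2real_mono) (auto simp: ennreal_mult_less_top)
  also have "\<dots> = C * enn2real (?I f)" using C by (simp add: enn2real_mult)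
  finally have "enn2real (?I g) powr (1 / enn2real p) \<le> (C * enn2real (?I f)) powr (1 / enn2real p)"
    by (intro powr_mono2) auto
  then show "Lp_norm p (ae_class g) \<le> C powr (1 / enn2real p) * Lp_norm p (ae_class f)"
    using assms(1) C by (simp add: Lp_norm.abs_eq powr_mult)
qed

text \<open>Pullbacks transport arbitrary almost everywhere bounds, hence the comparison with a
  general \<open>M\<close>; it is applied to the essential supremum of \<open>f\<close>, which is
  itself such a bound.\<close>

lemma Linfinity_dominated:
  assumes f: "ae_class f \<in> Lp \<infinity>" and g: "g \<in> borel_measurable box_measure"
    and le: "\<And>M. AE x in box_measure. ennreal (norm (f x)) \<le> M \<Longrightarrow>
      AE x in box_measure. ennreal (norm (g x)) \<le> ennreal C * M"
    and C: "0 \<le> C"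
  shows "ae_class g \<in> Lp \<infinity>" "Lp_norm \<infinity> (ae_class g) \<le> C * Lp_norm \<infinity> (ae_class f)"
proof -
  let ?E = "\<lambda>f. esssup box_measure (\<lambda>x. ennreal (norm (f x :: complex)))"
  have "AE x in box_measure. ennreal (norm (g x)) \<le> ennreal C * ?E f"
    by (rule le) (rule esssup_AE)
  then have E: "?E g \<le> ennreal C * ?E f" using g by (intro esssup_I) auto
  have fin: "ennreal C * ?E f < \<infinity>" using f by (simp add: ae_class_in_Lp_iff ennreal_mult_less_top)
  then show "ae_class g \<in> Lp \<infinity>" using E g by (simp add: ae_class_in_Lp_iff)
  show "Lp_norm \<infinity> (ae_class g) \<le> C * Lp_norm \<infinity> (ae_class f)"
    using enn2real_mono[OF E] fin C by (simp add: Lp_norm.abs_eq enn2real_mult)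
qed

lemma Lp_zero: "1 \<le> p \<Longrightarrow> 0 \<in> Lp p" and Lp_norm_zero: "1 \<le> p \<Longrightarrow> Lp_norm p 0 = 0"
proof -
  assume p: "1 \<le> p"
  have "esssup box_measure (\<lambda>x. 0 :: ennreal) \<le> 0" by (rule esssup_I) auto
  then show "0 \<in> Lp p" "Lp_norm p 0 = 0"
    by (simp_all add: zero_ae_fun_def ae_class_in_Lp_iff Lp_norm.abs_eq)
qed

lemma
  assumes p: "1 \<le> p" and u: "u \<in> Lp p"
  shows Lp_scale: "ae_scale c u \<in> Lp p"
    and Lp_norm_scale: "Lp_norm p (ae_scale c u) \<le> norm c * Lp_norm p u"
proof -
  obtain f where f: "u = ae_class f" by (rule ae_fun_cases)
  have [measurable]: "f \<in> borel_measurable box_measure" using u by (simp add: f ae_class_in_Lp_iff)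
  have "ae_scale c u \<in> Lp p \<and> Lp_norm p (ae_scale c u) \<le> norm c * Lp_norm p u"
  proof (cases "p = \<infinity>")
    case True
    have "AE x in box_measure. ennreal (norm (c * f x)) \<le> ennreal (norm c) * M"
      if "AE x in box_measure. ennreal (norm (f x)) \<le> M" for M
      using that by eventually_elim (simp add: norm_mult ennreal_mult mult_left_mono)
    then show ?thesis
      using u Linfinity_dominated[of f "\<lambda>x. c * f x" "norm c"]
      unfolding f True by (simp add: ae_scale.abs_eq)
  next
    case False
    have q: "0 < enn2real p" using p False by (rule enn2real_exponent_pos)
    have "(\<integral>\<^sup>+x. ennreal (norm (c * f x) powr enn2real p) \<partial>box_measure) \<le>
        ennreal (norm c powr enn2real p) * (\<integral>\<^sup>+x. ennreal (norm (f x) powr enn2real p) \<partial>box_measure)"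
      by (simp add: norm_mult powr_mult ennreal_mult nn_integral_cmult)
    from Lp_dominated[OF False _ _ _ this] show ?thesis
      using u q unfolding f by (simp add: ae_scale.abs_eq powr_powr)
  qed
  then show "ae_scale c u \<in> Lp p" "Lp_norm p (ae_scale c u) \<le> norm c * Lp_norm p u" by auto
qed

text \<open>Replacing the sum by twice the maximum works for every nonnegative exponent, so the
  inequality serves both for the exponent \<open>p\<close> under the integral and for
  \<open>1 / p\<close> outside it.\<close>

lemma powr_add_le:
  fixes x y s :: real
  assumes "0 \<le> x" "0 \<le> y" "0 \<le> s"
  shows "(x + y) powr s \<le> 2 powr s * (x powr s + y powr s)"
proof -
  have "(x + y) powr s \<le> (2 * max x y) powr s"
    using assms by (intro powr_mono2) auto
  also have "\<dots> = 2 powr s * max x y powr s" using assms by (simp add: powr_mult)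
  also have "\<dots> \<le> 2 powr s * (x powr s + y powr s)"
    by (intro mult_left_mono) (auto simp: max_def)
  finally show ?thesis .
qed

text \<open>The constant is not sharp; boundedness of operators only needs a quasi-norm, so Minkowski's
  inequality is avoided.\<close>

lemma Lp_add:
  assumes p: "1 \<le> p" and u: "u \<in> Lp p" and v: "v \<in> Lp p"
  shows "u + v \<in> Lp p"
    and Lp_norm_add: "Lp_norm p (u + v) \<le> 2 * 2 powr (1 / enn2real p) * (Lp_norm p u + Lp_norm p v)"
proof -
  obtain f g where f: "u = ae_class f" and g: "v = ae_class g" by (metis ae_fun_cases)
  have [measurable]: "f \<in> borel_measurable box_measure" "g \<in> borel_measurable box_measure"
    using u v by (simp_all add: f g ae_class_in_Lp_iff)
  have "u + v \<in> Lp p \<and> Lp_norm p (u + v) \<le> 2 * 2 powr (1 / enn2real p) * (Lp_norm p u + Lp_norm p v)"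
  proof (cases "p = \<infinity>")
    case True
    let ?E = "\<lambda>f. esssup box_measure (\<lambda>x. ennreal (norm (f x :: complex)))"
    \<comment> \<open>For infinite \<open>p\<close>, \<open>enn2real p\<close> is 0 and so is its
      reciprocal; the constant of the lemma becomes 2, while the triangle inequality gives 1. This
      absorbs the slack.\<close>
    have double: "s \<le> 2 * s" if "0 \<le> s" for s :: real using that by simp
    have "AE x in box_measure. ennreal (norm (f x + g x)) \<le> ?E f + ?E g"
      using esssup_AE[of "\<lambda>x. ennreal (norm (f x))" box_measure]
        esssup_AE[of "\<lambda>x. ennreal (norm (g x))" box_measure]
    proof eventually_elim
      case (elim x)
      have "ennreal (norm (f x + g x)) \<le> ennreal (norm (f x)) + ennreal (norm (g x))"
        by (simp add: ennreal_plus[symmetric] ennreal_leI norm_triangle_ineq del: ennreal_plus)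
      then show ?case using add_mono[OF elim] by (rule order_trans)
    qed
    then have E: "?E (\<lambda>x. f x + g x) \<le> ?E f + ?E g" by (intro esssup_I) auto
    have fin: "?E f < \<infinity>" "?E g < \<infinity>" using u v True by (simp_all add: f g ae_class_in_Lp_iff)
    have "enn2real (?E (\<lambda>x. f x + g x)) \<le> enn2real (?E f + ?E g)"
      using E fin by (intro enn2real_mono) auto
    also have "\<dots> = enn2real (?E f) + enn2real (?E g)" using fin by (intro enn2real_plus) auto
    also have "\<dots> \<le> 2 * (enn2real (?E f) + enn2real (?E g))"
      by (rule double) (intro add_nonneg_nonneg enn2real_nonneg)
    finally have "enn2real (?E (\<lambda>x. f x + g x)) \<le> 2 * (enn2real (?E f) + enn2real (?E g))" .
    moreover have "?E (\<lambda>x. f x + g x) < \<infinity>" using E fin by (auto intro: le_less_trans)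
    ultimately show ?thesis
      using True by (simp add: f g plus_ae_fun.abs_eq ae_class_in_Lp_iff Lp_norm.abs_eq)
  next
    case False
    let ?q = "enn2real p"
    let ?I = "\<lambda>f. \<integral>\<^sup>+x. ennreal (norm (f x :: complex) powr ?q) \<partial>box_measure"
    have q: "0 < ?q" using p False by (rule enn2real_exponent_pos)
    have fin: "?I f < \<infinity>" "?I g < \<infinity>" using u v False by (simp_all add: f g ae_class_in_Lp_iff)
    have "norm (f x + g x) powr ?q \<le> 2 powr ?q * (norm (f x) powr ?q + norm (g x) powr ?q)" for x
      using powr_mono2[OF less_imp_le[OF q] _ norm_triangle_ineq, of "f x" "g x"]
        powr_add_le[of "norm (f x)" "norm (g x)" ?q] q by simp
    then have "?I (\<lambda>x. f x + g x) \<le>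
        (\<integral>\<^sup>+x. ennreal (2 powr ?q * (norm (f x) powr ?q + norm (g x) powr ?q)) \<partial>box_measure)"
      by (intro nn_integral_mono ennreal_leI)
    also have "\<dots> = ennreal (2 powr ?q) * (?I f + ?I g)"
      by (simp add: ennreal_mult nn_integral_cmult nn_integral_add)
    finally have I: "?I (\<lambda>x. f x + g x) \<le> ennreal (2 powr ?q) * (?I f + ?I g)" .
    have fin2: "ennreal (2 powr ?q) * (?I f + ?I g) < \<infinity>" using fin by (simp add: ennreal_mult_less_top)
    define x y where "x = enn2real (?I f)" and "y = enn2real (?I g)"
    have xy: "0 \<le> x" "0 \<le> y" by (simp_all add: x_def y_def)
    have "enn2real (?I (\<lambda>x. f x + g x)) \<le> enn2real (ennreal (2 powr ?q) * (?I f + ?I g))"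
      using I fin2 by (intro enn2real_mono) auto
    also have "\<dots> = 2 powr ?q * (x + y)"
      using fin by (simp add: enn2real_mult enn2real_plus x_def y_def)
    finally have "enn2real (?I (\<lambda>x. f x + g x)) powr (1 / ?q) \<le> (2 powr ?q * (x + y)) powr (1 / ?q)"
      using q by (intro powr_mono2) auto
    \<comment> \<open>The factor 2 is the root of \<open>2 powr ?q\<close> from the pointwise
      inequality; the factor \<open>2 powr (1 / ?q)\<close> comes from splitting the root of the
      sum.\<close>
    also have "\<dots> = 2 * (x + y) powr (1 / ?q)" using xy q by (simp add: powr_mult powr_powr)
    also have "\<dots> \<le> 2 * (2 powr (1 / ?q) * (x powr (1 / ?q) + y powr (1 / ?q)))"
      using q xy by (intro mult_left_mono powr_add_le) auto
    finally show ?thesis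
      using le_less_trans[OF I fin2] False
      by (simp add: f g plus_ae_fun.abs_eq ae_class_in_Lp_iff Lp_norm.abs_eq x_def y_def mult.assoc)
  qed
  then show "u + v \<in> Lp p" "Lp_norm p (u + v) \<le> 2 * 2 powr (1 / enn2real p) * (Lp_norm p u + Lp_norm p v)"
    by auto
qed

section \<open>Algebra of bounded operators\<close>

lemma ae_scale_add_right: "ae_scale c (u + v) = ae_scale c u + ae_scale c v"
  and ae_scale_scale: "ae_scale c (ae_scale d u) = ae_scale (c * d) u"
  and ae_scale_one: "ae_scale 1 u = u"
  and ae_scale_zero_right: "ae_scale c 0 = 0"
  and ae_scale_zero_left: "ae_scale 0 u = 0"
  by (transfer; simp add: algebra_simps)+

lemma bounded_opsD:
  assumes "A \<in> bounded_ops p"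
  shows "u \<in> Lp p \<Longrightarrow> A u \<in> Lp p"
    and "u \<in> Lp p \<Longrightarrow> v \<in> Lp p \<Longrightarrow> A (u + v) = A u + A v"
    and "u \<in> Lp p \<Longrightarrow> A (ae_scale c u) = ae_scale c (A u)"
    and "A \<in> extensional (Lp p)"
  using assms by (auto simp: bounded_ops_def PiE_def)

text \<open>The definition allows any real \<open>K\<close>; a nonnegative one is what lets the
  bounds of two factors be chained in \<open>bounded_ops_mult\<close>.\<close>

lemma bounded_ops_bound:
  assumes "A \<in> bounded_ops p"
  shows "\<exists>K\<ge>0. \<forall>u\<in>Lp p. Lp_norm p (A u) \<le> K * Lp_norm p u"
proof -
  obtain K where K: "\<forall>u\<in>Lp p. Lp_norm p (A u) \<le> K * Lp_norm p u"
    using assms unfolding bounded_ops_def by blast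
  have "K * Lp_norm p u \<le> \<bar>K\<bar> * Lp_norm p u" for u
    by (intro mult_right_mono Lp_norm_nonneg) auto
  then show ?thesis using K by (meson abs_ge_zero order_trans)
qed

lemma operator_eqI:
  assumes "A \<in> extensional (Lp p)" "B \<in> extensional (Lp p)" "\<And>u. u \<in> Lp p \<Longrightarrow> A u = B u"
  shows "A = (B :: lp_operator)"
  using assms by (rule extensionalityI)

lemma extensional_ops [simp]:
  "op_id p \<in> extensional (Lp p)" "op_zero p \<in> extensional (Lp p)"
  "op_add p A B \<in> extensional (Lp p)" "op_scale p c A \<in> extensional (Lp p)"
  "op_mult p A B \<in> extensional (Lp p)" "op_inverse p A \<in> extensional (Lp p)"
  by (simp_all add: op_id_def op_zero_def op_add_def op_scale_def op_mult_def op_inverse_def compose_def)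

lemma op_apply:
  assumes "u \<in> Lp p"
  shows "op_id p u = u" "op_zero p u = 0" "op_add p A B u = A u + B u"
    "op_scale p c A u = ae_scale c (A u)" "op_mult p A B u = A (B u)"
    "op_inverse p A u = inv_into (Lp p) A u"
  using assms by (simp_all add: op_id_def op_zero_def op_add_def op_scale_def op_mult_def op_inverse_def compose_def)

lemma bounded_opsI:
  assumes "1 \<le> p" "A \<in> extensional (Lp p)" "\<And>u. u \<in> Lp p \<Longrightarrow> A u \<in> Lp p"
    "\<And>u v. u \<in> Lp p \<Longrightarrow> v \<in> Lp p \<Longrightarrow> A (u + v) = A u + A v"
    "\<And>c u. u \<in> Lp p \<Longrightarrow> A (ae_scale c u) = ae_scale c (A u)"
    "\<And>u. u \<in> Lp p \<Longrightarrow> Lp_norm p (A u) \<le> K * Lp_norm p u"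
  shows "A \<in> bounded_ops p"
  using assms by (auto simp: bounded_ops_def PiE_def intro!: exI[of _ K])

lemma bounded_ops_id: "1 \<le> p \<Longrightarrow> op_id p \<in> bounded_ops p"
  by (rule bounded_opsI[where K = 1]) (simp_all add: op_apply Lp_add Lp_scale)

lemma bounded_ops_zero: "1 \<le> p \<Longrightarrow> op_zero p \<in> bounded_ops p"
  by (rule bounded_opsI[where K = 0])
    (simp_all add: op_apply Lp_add Lp_scale Lp_zero Lp_norm_zero ae_scale_zero_right)

lemma bounded_ops_add:
  assumes p: "1 \<le> p" and A: "A \<in> bounded_ops p" and B: "B \<in> bounded_ops p"
  shows "op_add p A B \<in> bounded_ops p"
proof -
  obtain K where K: "\<And>u. u \<in> Lp p \<Longrightarrow> Lp_norm p (A u) \<le> K * Lp_norm p u"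
    using bounded_ops_bound[OF A] by blast
  obtain L where L: "\<And>u. u \<in> Lp p \<Longrightarrow> Lp_norm p (B u) \<le> L * Lp_norm p u"
    using bounded_ops_bound[OF B] by blast
  let ?C = "2 * 2 powr (1 / enn2real p)"
  show ?thesis
  proof (rule bounded_opsI[where K = "?C * (K + L)"])
    fix u assume u: "u \<in> Lp p"
    have "Lp_norm p (A u + B u) \<le> ?C * (Lp_norm p (A u) + Lp_norm p (B u))"
      by (rule Lp_norm_add[OF p bounded_opsD(1)[OF A u] bounded_opsD(1)[OF B u]])
    also have "\<dots> \<le> ?C * (K * Lp_norm p u + L * Lp_norm p u)"
      using K[OF u] L[OF u] by (intro mult_left_mono add_mono) auto
    finally show "Lp_norm p (op_add p A B u) \<le> ?C * (K + L) * Lp_norm p u"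
      using u by (simp add: op_apply algebra_simps)
  qed (use p in \<open>simp_all add: op_apply bounded_opsD[OF A] bounded_opsD[OF B] Lp_add Lp_scale ae_scale_add_right add_ac\<close>)
qed

lemma bounded_ops_scale:
  assumes p: "1 \<le> p" and A: "A \<in> bounded_ops p"
  shows "op_scale p c A \<in> bounded_ops p"
proof -
  obtain K where K: "\<And>u. u \<in> Lp p \<Longrightarrow> Lp_norm p (A u) \<le> K * Lp_norm p u"
    using bounded_ops_bound[OF A] by blast
  show ?thesis
  proof (rule bounded_opsI[where K = "norm c * K"])
    fix u assume u: "u \<in> Lp p"
    have "Lp_norm p (ae_scale c (A u)) \<le> norm c * Lp_norm p (A u)"
      by (rule Lp_norm_scale[OF p bounded_opsD(1)[OF A u]])
    also have "\<dots> \<le> norm c * (K * Lp_norm p u)" using K[OF u] by (intro mult_left_mono) auto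
    finally show "Lp_norm p (op_scale p c A u) \<le> norm c * K * Lp_norm p u"
      using u by (simp add: op_apply mult.assoc)
  qed (use p in \<open>simp_all add: op_apply bounded_opsD[OF A] Lp_add Lp_scale ae_scale_add_right ae_scale_scale mult.commute\<close>)
qed

lemma bounded_ops_mult:
  assumes p: "1 \<le> p" and A: "A \<in> bounded_ops p" and B: "B \<in> bounded_ops p"
  shows "op_mult p A B \<in> bounded_ops p"
proof -
  obtain K where K: "0 \<le> K" "\<forall>u\<in>Lp p. Lp_norm p (A u) \<le> K * Lp_norm p u"
    using bounded_ops_bound[OF A] by blast
  obtain L where L: "\<And>u. u \<in> Lp p \<Longrightarrow> Lp_norm p (B u) \<le> L * Lp_norm p u"
    using bounded_ops_bound[OF B] by blast
  show ?thesis
  proof (rule bounded_opsI[where K = "K * L"])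
    fix u assume u: "u \<in> Lp p"
    have "Lp_norm p (A (B u)) \<le> K * Lp_norm p (B u)" by (rule K(2)[rule_format, OF bounded_opsD(1)[OF B u]])
    also have "\<dots> \<le> K * (L * Lp_norm p u)" using L[OF u] K(1) by (intro mult_left_mono)
    finally show "Lp_norm p (op_mult p A B u) \<le> K * L * Lp_norm p u"
      using u by (simp add: op_apply mult.assoc)
  qed (use p in \<open>simp_all add: op_apply bounded_opsD[OF A] bounded_opsD[OF B] Lp_add Lp_scale\<close>)
qed

text \<open>The innermost operator must keep \<open>Lp p\<close>, since the restricted product of
  the other two has its meaning only there.\<close>

lemma op_mult_assoc:
  assumes "C \<in> bounded_ops p"
  shows "op_mult p (op_mult p A B) C = op_mult p A (op_mult p B C)"
  by (rule operator_eqI[where p = p]) (simp_all add: op_apply bounded_opsD[OF assms])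

lemma op_mult_id:
  assumes "A \<in> bounded_ops p"
  shows "op_mult p (op_id p) A = A" "op_mult p A (op_id p) = A"
  by (rule operator_eqI[where p = p]; simp add: op_apply bounded_opsD[OF assms])+

lemma op_scale_scale:
  "op_scale p c (op_scale p d A) = op_scale p (c * d) A"
  by (rule operator_eqI[where p = p]) (simp_all add: op_apply ae_scale_scale)

lemma op_scale_one:
  assumes "A \<in> bounded_ops p"
  shows "op_scale p 1 A = A"
  by (rule operator_eqI[where p = p]) (simp_all add: op_apply ae_scale_one bounded_opsD[OF assms])

lemma op_mult_scale:
  assumes "A \<in> bounded_ops p" "B \<in> bounded_ops p"
  shows "op_mult p (op_scale p c A) B = op_scale p c (op_mult p A B)"
    and "op_mult p A (op_scale p c B) = op_scale p c (op_mult p A B)"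
  by (rule operator_eqI[where p = p];
      simp add: op_apply bounded_opsD[OF assms(1)] bounded_opsD[OF assms(2)])+

text \<open>\<open>op_inverse\<close> is built from a choice of preimages; a left inverse makes
  \<open>A\<close> injective, which leaves no choice, and the right inverse exhibits the preimage
  \<open>B u\<close>.\<close>

lemma op_inverse_eqI:
  assumes A: "A \<in> bounded_ops p" and B: "B \<in> bounded_ops p"
    and AB: "op_mult p A B = op_id p" and BA: "op_mult p B A = op_id p"
  shows "op_inverse p A = B"
proof (rule operator_eqI[where p = p])
  fix u assume u: "u \<in> Lp p"
  have "B (A v) = v" if "v \<in> Lp p" for v
    using fun_cong[OF BA, of v] that by (simp add: op_apply)
  then have "inj_on A (Lp p)" by (rule inj_on_inverseI)
  then have "inv_into (Lp p) A (A (B u)) = B u" using bounded_opsD(1)[OF B u] by (rule inv_into_f_f)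
  moreover have "A (B u) = u" using fun_cong[OF AB, of u] u by (simp add: op_apply)
  ultimately show "op_inverse p A u = B u" using u by (simp add: op_apply)
qed (simp_all add: bounded_opsD(4)[OF B])

lemma operator_algebra_generated:
  assumes p: "1 \<le> p" and G: "G \<subseteq> bounded_ops p"
  shows "operator_algebra p (generated_algebra p G)"
proof -
  have "A \<in> bounded_ops p" if "A \<in> generated_algebra p G" for A
    using that by induction
      (use G in \<open>auto intro: p bounded_ops_zero bounded_ops_add bounded_ops_scale bounded_ops_mult\<close>)
  then show ?thesis
    by (auto simp: operator_algebra_def intro: generated_algebra.intros)
qed

text \<open>The operators commuting with a fixed bounded linear \<open>B\<close> are closed under
  all operations that generate the algebra.\<close>

lemma generated_algebra_centralizes:
  assumes p: "1 \<le> p" and G: "G \<subseteq> bounded_ops p" and B: "B \<in> bounded_ops p"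
    and comm: "\<And>A. A \<in> G \<Longrightarrow> op_mult p A B = op_mult p B A"
    and A: "A \<in> generated_algebra p G"
  shows "op_mult p A B = op_mult p B A"
proof -
  have X: "X \<in> bounded_ops p" if "X \<in> generated_algebra p G" for X
    using operator_algebra_generated[OF p G] that by (auto simp: operator_algebra_def)
  show ?thesis using A
  proof induction
    case zero
    \<comment> \<open>Commuting with the zero operator amounts to \<open>B 0 = 0\<close>, which
      follows from homogeneity with factor 0.\<close>
    have "B 0 = ae_scale 0 (B 0)"
      using B Lp_zero[OF p] bounded_opsD(3)[OF B, of 0 0] by (simp add: ae_scale_zero_right)
    then have "B 0 = 0" by (simp add: ae_scale_zero_left)
    then show ?case by (intro operator_eqI[where p = p]) (simp_all add: op_apply bounded_opsD[OF B])
  next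
    case (gen A)
    then show ?case by (rule comm)
  next
    case (add A C)
    show ?case
    proof (rule operator_eqI[where p = p])
      fix u assume u: "u \<in> Lp p"
      have "A (B u) = B (A u)" "C (B u) = B (C u)"
        using fun_cong[OF add.IH(1), of u] fun_cong[OF add.IH(2), of u] u by (simp_all add: op_apply)
      then have "op_mult p (op_add p A C) B u = B (A u) + B (C u)"
        using u bounded_opsD(1)[OF B u] by (simp only: op_apply)
      also have "\<dots> = B (A u + C u)"
        using bounded_opsD(1)[OF X[OF add.hyps(1)] u] bounded_opsD(1)[OF X[OF add.hyps(2)] u]
        by (rule bounded_opsD(2)[OF B, symmetric])
      finally show "op_mult p (op_add p A C) B u = op_mult p B (op_add p A C) u"
        using u by (simp only: op_apply)
    qed simp_all
  next
    case (scale A c)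
    then show ?case using B X by (simp add: op_mult_scale)
  next
    case (mult A C)
    then show ?case using B X by (metis op_mult_assoc)
  qed
qed

text \<open>The centralizer argument is used twice: with a generator as the fixed operator, and with
  an arbitrary element of the algebra, which the former use has shown to commute with all
  generators.\<close>

lemma commutative_generated_algebra:
  assumes p: "1 \<le> p" and G: "G \<subseteq> bounded_ops p"
    and comm: "\<And>A B. A \<in> G \<Longrightarrow> B \<in> G \<Longrightarrow> op_mult p A B = op_mult p B A"
  shows "commutative_ops p (generated_algebra p G)"
  unfolding commutative_ops_def
proof (intro ballI)
  fix A B assume A: "A \<in> generated_algebra p G" and B: "B \<in> generated_algebra p G"
  have "op_mult p B C = op_mult p C B" if "C \<in> G" for C
    using that G comm by (intro generated_algebra_centralizes[OF p G _ _ B]) auto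
  moreover have "B \<in> bounded_ops p"
    using operator_algebra_generated[OF p G] B by (auto simp: operator_algebra_def)
  ultimately show "op_mult p A B = op_mult p B A"
    by (intro generated_algebra_centralizes[OF p G _ _ A]) auto
qed

section \<open>Operators given by pointwise formulas\<close>

lemma extends_to_boundedD:
  assumes "extends_to_bounded p \<Phi>"
  shows "Lp_op p \<Phi> \<in> bounded_ops p"
    and "ae_class f \<in> Lp p \<Longrightarrow> Lp_op p \<Phi> (ae_class f) = ae_class (\<Phi> f)"
    and "ae_class f \<in> Lp p \<Longrightarrow> ae_class (\<Phi> f) \<in> Lp p"
proof -
  show 1: "Lp_op p \<Phi> \<in> bounded_ops p"
    and 2: "ae_class f \<in> Lp p \<Longrightarrow> Lp_op p \<Phi> (ae_class f) = ae_class (\<Phi> f)"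
    using assms by (auto simp: extends_to_bounded_def)
  show "ae_class f \<in> Lp p \<Longrightarrow> ae_class (\<Phi> f) \<in> Lp p"
    using bounded_opsD(1)[OF 1, of "ae_class f"] 2 by simp
qed

text \<open>Linearity of the formula may be asked pointwise, because the congruence hypothesis lets
  every class be evaluated at any chosen representative, in particular at a sum or multiple of given
  ones.\<close>

lemma extends_to_boundedI:
  assumes p: "1 \<le> p"
    and cong: "\<And>f g. AE x in box_measure. f x = g x \<Longrightarrow> AE x in box_measure. \<Phi> f x = \<Phi> g x"
    and add: "\<And>f g x. \<Phi> (\<lambda>x. f x + g x) x = \<Phi> f x + \<Phi> g x"
    and scale: "\<And>c f x. \<Phi> (\<lambda>x. c * f x) x = c * \<Phi> f x"
    and bound: "\<And>f. ae_class f \<in> Lp p \<Longrightarrow>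
      ae_class (\<Phi> f) \<in> Lp p \<and> Lp_norm p (ae_class (\<Phi> f)) \<le> K * Lp_norm p (ae_class f)"
  shows "extends_to_bounded p \<Phi>"
proof -
  have apply_class: "Lp_op p \<Phi> (ae_class f) = ae_class (\<Phi> f)" if "ae_class f \<in> Lp p" for f
  proof -
    have "AE x in box_measure. ae_rep (ae_class f) x = f x"
      using ae_class_ae_rep[of "ae_class f"] by (simp add: ae_class_eq_iff)
    then show ?thesis using that by (simp add: Lp_op_def ae_class_eq_iff cong)
  qed
  have add': "\<Phi> (\<lambda>x. f x + g x) = (\<lambda>x. \<Phi> f x + \<Phi> g x)" for f g by (rule ext) (rule add)
  have scale': "\<Phi> (\<lambda>x. c * f x) = (\<lambda>x. c * \<Phi> f x)" for c f by (rule ext) (rule scale)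
  have "Lp_op p \<Phi> \<in> bounded_ops p"
  proof (rule bounded_opsI[OF p, where K = K])
    show "Lp_op p \<Phi> \<in> extensional (Lp p)" by (simp add: Lp_op_def)
  next
    fix u assume u: "u \<in> Lp p"
    obtain f where f: "u = ae_class f" by (rule ae_fun_cases)
    show "Lp_op p \<Phi> u \<in> Lp p" "Lp_norm p (Lp_op p \<Phi> u) \<le> K * Lp_norm p u"
      using bound[of f] u by (simp_all add: f apply_class)
    show "Lp_op p \<Phi> (ae_scale c u) = ae_scale c (Lp_op p \<Phi> u)" for c
      using Lp_scale[OF p u, of c] u by (simp add: f ae_scale.abs_eq apply_class scale')
    fix v assume v: "v \<in> Lp p"
    obtain g where g: "v = ae_class g" by (rule ae_fun_cases)
    show "Lp_op p \<Phi> (u + v) = Lp_op p \<Phi> u + Lp_op p \<Phi> v"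
      using Lp_add(1)[OF p u v] u v by (simp add: f g plus_ae_fun.abs_eq apply_class add')
  qed
  then show ?thesis using apply_class by (auto simp: extends_to_bounded_def)
qed

lemma extends_to_bounded_zero:
  assumes "1 \<le> p"
  shows "extends_to_bounded p (\<lambda>f x. 0)"
  using Lp_zero[OF assms] Lp_norm_zero[OF assms]
  by (intro extends_to_boundedI[OF assms, where K = 0]) (simp_all add: zero_ae_fun_def)

lemma extends_to_bounded_add:
  assumes p: "1 \<le> p" and \<Phi>: "extends_to_bounded p \<Phi>" and \<Psi>: "extends_to_bounded p \<Psi>"
  shows "extends_to_bounded p (\<lambda>f x. \<Phi> f x + \<Psi> f x)"
proof -
  have eq: "Lp_op p (\<lambda>f x. \<Phi> f x + \<Psi> f x) = op_add p (Lp_op p \<Phi>) (Lp_op p \<Psi>)"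
    by (rule operator_eqI[where p = p]) (simp_all add: op_apply Lp_op_def plus_ae_fun.abs_eq)
  then have "Lp_op p (\<lambda>f x. \<Phi> f x + \<Psi> f x) \<in> bounded_ops p"
    using \<Phi> \<Psi> p by (simp add: bounded_ops_add extends_to_boundedD(1))
  moreover have "Lp_op p (\<lambda>f x. \<Phi> f x + \<Psi> f x) (ae_class f) = ae_class (\<lambda>x. \<Phi> f x + \<Psi> f x)"
    if "ae_class f \<in> Lp p" for f
    using that by (simp add: eq op_apply extends_to_boundedD(2)[OF \<Phi>] extends_to_boundedD(2)[OF \<Psi>]
        plus_ae_fun.abs_eq)
  ultimately show ?thesis by (simp add: extends_to_bounded_def)
qed

lemma extends_to_bounded_sum:
  fixes n :: nat
  assumes "1 \<le> p" "\<And>k. k < n \<Longrightarrow> extends_to_bounded p (\<Phi> k)"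
  shows "extends_to_bounded p (\<lambda>f x. \<Sum>k<n. \<Phi> k f x)"
  using assms(2)
proof (induction n)
  case 0
  then show ?case using extends_to_bounded_zero[OF assms(1)] by simp
next
  case (Suc n)
  then show ?case using extends_to_bounded_add[OF assms(1)] by simp
qed

text \<open>The shape of a single summand of T_m or S_m. The averaging factor \<open>1 / m\<close>
  is put into the weight, so all weights have modulus at most 1.\<close>

definition weighted_pullback ::
    "(real \<times> real \<Rightarrow> complex) \<Rightarrow> (real \<times> real \<Rightarrow> real \<times> real) \<Rightarrow> (real \<times> real \<Rightarrow> complex) \<Rightarrow>
      (real \<times> real \<Rightarrow> complex)" where
  "weighted_pullback w \<phi> f = (\<lambda>x. w x * twisted_ext f (fst (\<phi> x)) (snd (\<phi> x)))"

text \<open>The twist is a phase. Hence the absolute value of the extension is genuinely periodic in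
  both variables, as the covering estimate requires.\<close>

lemma norm_twisted_ext: "norm (twisted_ext f a c) = norm (f (frac a, frac c))"
  by (simp add: twisted_ext_def norm_mult)

lemma AE_twisted_ext_eq: "AE x in box_measure. twisted_ext f (fst x) (snd x) = f x"
  unfolding AE_box_measure_iff using AE_lebesgue_box_iff_half_open
  by eventually_elim (auto simp: twisted_ext_square)

lemma borel_measurable_weighted_pullback:
  assumes "\<alpha> \<noteq> 0" "\<gamma> \<noteq> 0" and "w \<in> borel_measurable lebesgue" and "f \<in> borel_measurable box_measure"
  shows "weighted_pullback w (axis_affine \<alpha> \<beta> \<gamma> \<delta>) f \<in> borel_measurable lebesgue"
  unfolding weighted_pullback_def
  using measurable_compose[OF measurable_axis_affine[OF assms(1,2)] borel_measurable_twisted_ext[OF assms(4)]]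
  by (intro borel_measurable_times assms(3))

text \<open>For finite \<open>p\<close> the covering estimate applies to the \<open>p\<close>-th
  power of the absolute value of the extension. For infinite \<open>p\<close> a bound on the square
  spreads to the plane by periodicity and is pulled back along the affine map.\<close>

lemma extends_to_bounded_weighted_pullback:
  assumes p: "1 \<le> p" and nz: "\<alpha> \<noteq> 0" "\<gamma> \<noteq> 0"
    and w: "w \<in> borel_measurable lebesgue" and w_le: "\<And>x. norm (w x) \<le> 1"
  shows "extends_to_bounded p (weighted_pullback w (axis_affine \<alpha> \<beta> \<gamma> \<delta>))"
proof -
  let ?\<phi> = "axis_affine \<alpha> \<beta> \<gamma> \<delta>"
  let ?P = "weighted_pullback w ?\<phi>"
  obtain C :: real where C: "C \<ge> 0" "\<And>h :: real \<times> real \<Rightarrow> ennreal. \<lbrakk>h \<in> borel_measurable lebesgue;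
        \<And>a c i j. h (a + of_int i, c + of_int j) = h (a, c)\<rbrakk> \<Longrightarrow>
        (\<integral>\<^sup>+x. h (?\<phi> x) \<partial>box_measure) \<le> ennreal C * (\<integral>\<^sup>+x. h x \<partial>box_measure)"
    using nn_integral_box_periodic_affine_le[OF nz, of \<beta> \<delta>] by blast
  have norm_le: "norm (?P f x) \<le> norm (twisted_ext f (fst (?\<phi> x)) (snd (?\<phi> x)))" for f x
    using mult_right_mono[OF w_le norm_ge_zero] by (simp add: weighted_pullback_def norm_mult)
  have bound: "ae_class (?P f) \<in> Lp p \<and> Lp_norm p (ae_class (?P f)) \<le>
      (if p = \<infinity> then 1 else C powr (1 / enn2real p)) * Lp_norm p (ae_class f)"
    if f: "ae_class f \<in> Lp p" for f
  proof -
    have fm: "f \<in> borel_measurable box_measure" using f by (simp add: ae_class_in_Lp_iff)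
    have Pm: "?P f \<in> borel_measurable box_measure"
      by (intro borel_measurable_box_measure borel_measurable_weighted_pullback nz w fm)
    show ?thesis
    proof (cases "p = \<infinity>")
      case True
      have "AE x in box_measure. ennreal (norm (?P f x)) \<le> ennreal 1 * M"
        if M: "AE x in box_measure. ennreal (norm (f x)) \<le> M" for M
      proof -
        have "AE x in lebesgue. ennreal (norm (f (frac (fst (?\<phi> x)), frac (snd (?\<phi> x))))) \<le> M"
          by (rule AE_axis_affine[OF nz AE_lebesgue_frac[OF M]])
        then have "AE x in lebesgue. ennreal (norm (?P f x)) \<le> M"
        proof eventually_elim
          case (elim x)
          show ?case
            using norm_le[of f x] elim by (auto simp: norm_twisted_ext intro: order_trans[OF ennreal_leI])
        qed
        then show ?thesis
          unfolding AE_box_measure_iff by eventually_elim simp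
      qed
      then show ?thesis
        using Linfinity_dominated[of f "?P f" 1] f Pm True by simp
    next
      case False
      define h where "h x = ennreal (norm (twisted_ext f (fst x) (snd x)) powr enn2real p)" for x
      have h: "h \<in> borel_measurable lebesgue"
        using borel_measurable_twisted_ext[OF fm] unfolding h_def by measurable
      have "(\<integral>\<^sup>+x. ennreal (norm (?P f x) powr enn2real p) \<partial>box_measure) \<le> (\<integral>\<^sup>+x. h (?\<phi> x) \<partial>box_measure)"
        unfolding h_def by (intro nn_integral_mono ennreal_leI powr_mono2 norm_le) auto
      also have "\<dots> \<le> ennreal C * (\<integral>\<^sup>+x. h x \<partial>box_measure)"
        by (intro C(2) h) (simp add: h_def norm_twisted_ext frac_def)
      also have "(\<integral>\<^sup>+x. h x \<partial>box_measure) = (\<integral>\<^sup>+x. ennreal (norm (f x) powr enn2real p) \<partial>box_measure)"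
        using AE_twisted_ext_eq[of f] by (intro nn_integral_cong_AE, eventually_elim) (simp add: h_def)
      finally show ?thesis
        using Lp_dominated[OF False f Pm C(1)] False by simp
    qed
  qed
  show ?thesis
  proof (rule extends_to_boundedI[OF p _ _ _ bound])
    fix f g :: "real \<times> real \<Rightarrow> complex"
    assume "AE x in box_measure. f x = g x"
    \<comment> \<open>Independence of the representative: the exceptional null set, repeated over
      all cells, has a null preimage under the affine map.\<close>
    from AE_axis_affine[OF nz AE_lebesgue_frac[OF this], of \<beta> \<delta>]
    show "AE x in box_measure. ?P f x = ?P g x"
      unfolding AE_box_measure_iff
      by eventually_elim (simp add: weighted_pullback_def twisted_ext_def)
  qed (simp_all add: weighted_pullback_def twisted_ext_def algebra_simps)
qed

section \<open>The Hecke operators\<close>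

lemma hecke_T_eq_sum:
  "hecke_T m = (\<lambda>f x. \<Sum>k<m. weighted_pullback (\<lambda>_. 1 / of_nat m)
     (axis_affine (1 / real m) (real k / real m) (real m) 0) f x)"
  by (auto simp: hecke_T_def weighted_pullback_def axis_affine_def fun_eq_iff atLeast0LessThan
      sum_divide_distrib add_divide_distrib)

lemma hecke_S_eq_sum:
  "hecke_S m = (\<lambda>f x. \<Sum>k<m. weighted_pullback (\<lambda>x. expi2pi (real k * fst x) / of_nat m)
     (axis_affine (real m) 0 (1 / real m) (real k / real m)) f x)"
  by (auto simp: hecke_S_def weighted_pullback_def axis_affine_def fun_eq_iff atLeast0LessThan
      sum_divide_distrib add_divide_distrib)

lemma borel_measurable_expi2pi_fst:
  "(\<lambda>x :: real \<times> real. expi2pi (real k * fst x) / of_nat m) \<in> borel_measurable lebesgue"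
proof -
  have "continuous_on UNIV (\<lambda>x :: real \<times> real. expi2pi (real k * fst x) / of_nat m)"
    unfolding expi2pi_def divide_inverse by (intro continuous_intros)
  then show ?thesis by (intro measurable_completion) (simp add: borel_measurable_continuous_onI)
qed

lemma norm_divide_of_nat_le: "norm z \<le> 1 \<Longrightarrow> norm (z / of_nat m :: complex) \<le> 1"
  by (cases "m = 0") (auto simp: norm_divide divide_le_eq intro: order_trans)

lemma extends_to_bounded_hecke:
  assumes "1 \<le> p" "m \<ge> 1"
  shows "extends_to_bounded p (hecke_T m)" "extends_to_bounded p (hecke_S m)"
  unfolding hecke_T_eq_sum hecke_S_eq_sum using assms
  by (auto intro!: extends_to_bounded_sum extends_to_bounded_weighted_pullback
      borel_measurable_expi2pi_fst norm_divide_of_nat_le)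

lemma T_op_bounded: "1 \<le> p \<Longrightarrow> m \<ge> 1 \<Longrightarrow> T_op p m \<in> bounded_ops p"
  and S_op_bounded: "1 \<le> p \<Longrightarrow> m \<ge> 1 \<Longrightarrow> S_op p m \<in> bounded_ops p"
  by (simp_all add: T_op_def S_op_def extends_to_boundedD extends_to_bounded_hecke)

lemma T_op_apply:
    "1 \<le> p \<Longrightarrow> m \<ge> 1 \<Longrightarrow> ae_class f \<in> Lp p \<Longrightarrow> T_op p m (ae_class f) = ae_class (hecke_T m f)"
  and S_op_apply:
    "1 \<le> p \<Longrightarrow> m \<ge> 1 \<Longrightarrow> ae_class f \<in> Lp p \<Longrightarrow> S_op p m (ae_class f) = ae_class (hecke_S m f)"
  by (simp_all add: T_op_def S_op_def extends_to_boundedD extends_to_bounded_hecke)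

lemma T_vee_op_eq: "m \<ge> 1 \<Longrightarrow> T_vee_op p m = T_op p m"
  by (simp add: T_vee_op_def T_op_def Lp_op_def hecke_T_vee_eq)

lemma S_vee_op_eq: "S_vee_op p m = S_op p m"
  by (simp add: S_vee_op_def S_op_def Lp_op_def hecke_S_vee_eq)

lemma
  assumes p: "1 \<le> p" and m: "m \<ge> 1"
  shows T_op_S_op: "op_mult p (T_op p m) (S_op p m) = op_scale p (1 / of_nat m) (op_id p)"
    and S_op_T_op: "op_mult p (S_op p m) (T_op p m) = op_scale p (1 / of_nat m) (op_id p)"
proof -
  note ext = extends_to_boundedD(3)[OF extends_to_bounded_hecke(1)[OF p m]]
    extends_to_boundedD(3)[OF extends_to_bounded_hecke(2)[OF p m]]
  \<comment> \<open>Turns a pointwise identity with \<open>twisted_ext f\<close> into one between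
    classes, since the extension agrees with \<open>f\<close> off a null set of the square.\<close>
  have eq: "ae_class g = ae_scale (1 / of_nat m) (ae_class f)"
    if "\<And>a c. g (a, c) = twisted_ext f a c / of_nat m" for f g
    unfolding ae_scale.abs_eq ae_class_eq_iff using AE_twisted_ext_eq[of f]
    by eventually_elim (metis (no_types) that divide_inverse inverse_eq_divide mult.commute prod.collapse)
  show "op_mult p (T_op p m) (S_op p m) = op_scale p (1 / of_nat m) (op_id p)"
  proof (rule operator_eqI[where p = p])
    fix u assume u: "u \<in> Lp p"
    obtain f where f: "u = ae_class f" by (rule ae_fun_cases)
    show "op_mult p (T_op p m) (S_op p m) u = op_scale p (1 / of_nat m) (op_id p) u"
      using u p m by (simp add: op_apply f T_op_apply S_op_apply ext eq[OF hecke_T_S])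
  qed simp_all
  show "op_mult p (S_op p m) (T_op p m) = op_scale p (1 / of_nat m) (op_id p)"
  proof (rule operator_eqI[where p = p])
    fix u assume u: "u \<in> Lp p"
    obtain f where f: "u = ae_class f" by (rule ae_fun_cases)
    show "op_mult p (S_op p m) (T_op p m) u = op_scale p (1 / of_nat m) (op_id p) u"
      using u p m by (simp add: op_apply f T_op_apply S_op_apply ext eq[OF hecke_S_T])
  qed simp_all
qed

lemma T_op_mult:
  assumes p: "1 \<le> p" and m: "m \<ge> 1" and n: "n \<ge> 1"
  shows "op_mult p (T_op p m) (T_op p n) = T_op p (m * n)"
proof (rule operator_eqI[where p = p])
  fix u assume u: "u \<in> Lp p"
  obtain f where f: "u = ae_class f" by (rule ae_fun_cases)
  have "m * n \<ge> 1" using m n by simp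
  then show "op_mult p (T_op p m) (T_op p n) u = T_op p (m * n) u"
    using u p m n extends_to_boundedD(3)[OF extends_to_bounded_hecke(1)[OF p n]]
    by (simp add: op_apply f T_op_apply hecke_T_mult)
qed (use p m n in \<open>simp_all add: bounded_opsD(4)[OF T_op_bounded]\<close>)

text \<open>With T S = S T = c, the chain c A S = S T A S = S A T S = c S A gives the claim after
  division by c.\<close>

lemma commutes_with_inverse:
  assumes p: "1 \<le> p" and A: "A \<in> bounded_ops p" and T: "T \<in> bounded_ops p" and S: "S \<in> bounded_ops p"
    and TS: "op_mult p T S = op_scale p c (op_id p)" and ST: "op_mult p S T = op_scale p c (op_id p)"
    and c: "c \<noteq> 0" and comm: "op_mult p A T = op_mult p T A"
  shows "op_mult p A S = op_mult p S A"
proof -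
  have "op_scale p c (op_mult p A S) = op_mult p (op_mult p S T) (op_mult p A S)"
    using p A S by (simp add: ST op_mult_scale op_mult_id bounded_ops_id bounded_ops_mult)
  also have "\<dots> = op_mult p (op_mult p S A) (op_mult p T S)"
    using p A T S comm by (metis op_mult_assoc bounded_ops_mult)
  also have "\<dots> = op_scale p c (op_mult p S A)"
    using p A S by (simp add: TS op_mult_scale op_mult_id bounded_ops_id bounded_ops_mult)
  finally have "op_scale p (inverse c) (op_scale p c (op_mult p A S)) =
      op_scale p (inverse c) (op_scale p c (op_mult p S A))" by simp
  then show ?thesis using c p A S by (simp add: op_scale_scale op_scale_one bounded_ops_mult)
qed

lemma hecke_ops_commute:
  assumes p: "1 \<le> p" and m: "m \<ge> 1" and n: "n \<ge> 1"
  shows "op_mult p (T_op p m) (T_op p n) = op_mult p (T_op p n) (T_op p m)"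
    and "op_mult p (T_op p m) (S_op p n) = op_mult p (S_op p n) (T_op p m)"
    and "op_mult p (S_op p m) (S_op p n) = op_mult p (S_op p n) (S_op p m)"
proof -
  have TT: "op_mult p (T_op p m) (T_op p n) = op_mult p (T_op p n) (T_op p m)"
    if "m \<ge> 1" "n \<ge> 1" for m n
    using that p by (simp add: T_op_mult mult.commute)
  have TS: "op_mult p (T_op p m) (S_op p n) = op_mult p (S_op p n) (T_op p m)"
    if "m \<ge> 1" "n \<ge> 1" for m n
    using that TT[OF that]
    by (intro commutes_with_inverse[OF p _ _ _ T_op_S_op[OF p] S_op_T_op[OF p]])
      (simp_all add: p T_op_bounded S_op_bounded)
  show "op_mult p (T_op p m) (T_op p n) = op_mult p (T_op p n) (T_op p m)"
    "op_mult p (T_op p m) (S_op p n) = op_mult p (S_op p n) (T_op p m)"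
    using m n by (rule TT, rule TS)
  show "op_mult p (S_op p m) (S_op p n) = op_mult p (S_op p n) (S_op p m)"
    \<comment> \<open>Now S_m plays the role of the operator known to commute with T_n.\<close>
    using m n TS[OF n m, symmetric]
    by (intro commutes_with_inverse[OF p _ _ _ T_op_S_op[OF p] S_op_T_op[OF p]])
      (simp_all add: p T_op_bounded S_op_bounded)
qed

section \<open>Adjoints\<close>

text \<open>The product is dominated by the sum of the two squared absolute values.\<close>

lemma L2_integrable_mult_cnj:
  assumes "ae_class f \<in> Lp 2" "ae_class g \<in> Lp 2"
  shows "integrable box_measure (\<lambda>x. f x * cnj (g x))"
proof -
  have [measurable]: "f \<in> borel_measurable box_measure" "g \<in> borel_measurable box_measure"
    and fin: "(\<integral>\<^sup>+x. ennreal (norm (f x) ^ 2) \<partial>box_measure) < \<infinity>"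
      "(\<integral>\<^sup>+x. ennreal (norm (g x) ^ 2) \<partial>box_measure) < \<infinity>"
    using assms by (simp_all add: ae_class_in_Lp_iff)
  have "norm (f x * cnj (g x)) \<le> norm (f x) ^ 2 + norm (g x) ^ 2" for x
  proof -
    have "norm (f x * cnj (g x)) \<le> 2 * norm (f x) * norm (g x)" by (simp add: norm_mult)
    then show ?thesis using sum_squares_bound[of "norm (f x)" "norm (g x)"] by (rule order_trans)
  qed
  then have "(\<integral>\<^sup>+x. ennreal (norm (f x * cnj (g x))) \<partial>box_measure) \<le>
      (\<integral>\<^sup>+x. ennreal (norm (f x) ^ 2) + ennreal (norm (g x) ^ 2) \<partial>box_measure)"
    by (intro nn_integral_mono) (simp add: ennreal_plus[symmetric] ennreal_leI del: ennreal_plus)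
  also have "\<dots> = (\<integral>\<^sup>+x. ennreal (norm (f x) ^ 2) \<partial>box_measure) + (\<integral>\<^sup>+x. ennreal (norm (g x) ^ 2) \<partial>box_measure)"
    by (intro nn_integral_add) measurable
  also have "\<dots> < \<infinity>" using fin by simp
  finally have "(\<integral>\<^sup>+x. ennreal (norm (f x * cnj (g x))) \<partial>box_measure) < \<infinity>" .
  moreover have "(\<lambda>x. f x * cnj (g x)) \<in> borel_measurable box_measure"
    by (intro borel_measurable_times borel_measurable_continuous_on[of cnj]) (auto intro!: continuous_intros)
  ultimately show ?thesis by (intro integrableI_bounded)
qed

lemma L2_inner_add_left:
  assumes "u \<in> Lp 2" "v \<in> Lp 2" "w \<in> Lp 2"
  shows "L2_inner (u + v) w = L2_inner u w + L2_inner v w"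
proof -
  obtain f g h where "u = ae_class f" "v = ae_class g" "w = ae_class h" by (metis ae_fun_cases)
  with assms show ?thesis
    by (simp add: plus_ae_fun.abs_eq L2_inner.abs_eq distrib_right L2_integrable_mult_cnj)
qed

lemma L2_inner_scale_left: "L2_inner (ae_scale c u) v = c * L2_inner u v"
  by transfer (simp add: mult.assoc)

lemma L2_inner_cnj: "L2_inner v u = cnj (L2_inner u v)"
proof -
  obtain f g where "u = ae_class f" "v = ae_class g" by (metis ae_fun_cases)
  then show ?thesis
    using Bochner_Integration.integral_cnj[of box_measure "\<lambda>x. f x * cnj (g x)"] by (simp add: L2_inner.abs_eq mult.commute)
qed

lemma L2_inner_zero_left: "L2_inner 0 v = 0"
  by transfer simp

lemma is_adjoint_sym:
  assumes "is_adjoint A B"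
  shows "is_adjoint B A"
proof -
  have "L2_inner (B u) v = L2_inner u (A v)" if "u \<in> Lp 2" "v \<in> Lp 2" for u v
  proof -
    have "L2_inner (B u) v = cnj (L2_inner v (B u))" by (rule L2_inner_cnj)
    also have "L2_inner v (B u) = L2_inner (A v) u" using assms that by (simp add: is_adjoint_def)
    also have "cnj (L2_inner (A v) u) = L2_inner u (A v)" by (rule L2_inner_cnj[symmetric])
    finally show ?thesis .
  qed
  then show ?thesis using assms by (simp add: is_adjoint_def)
qed

lemma L2_exponent: "1 \<le> (2 :: ennreal)"
  by simp

lemma is_adjoint_zero: "is_adjoint (op_zero 2) (op_zero 2)"
  unfolding is_adjoint_def
  by (metis L2_exponent L2_inner_cnj L2_inner_zero_left bounded_ops_zero complex_cnj_zero op_apply(2))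

lemma is_adjoint_add:
  assumes "is_adjoint A B" "is_adjoint C D"
  shows "is_adjoint (op_add 2 A C) (op_add 2 B D)"
proof -
  have bd: "A \<in> bounded_ops 2" "B \<in> bounded_ops 2" "C \<in> bounded_ops 2" "D \<in> bounded_ops 2"
    using assms by (auto simp: is_adjoint_def)
  have "L2_inner (A u + C u) v = L2_inner u (B v + D v)" if u: "u \<in> Lp 2" and v: "v \<in> Lp 2" for u v
  proof -
    note mem = bounded_opsD(1)[OF bd(1) u] bounded_opsD(1)[OF bd(3) u]
      bounded_opsD(1)[OF bd(2) v] bounded_opsD(1)[OF bd(4) v]
    have "L2_inner (A u + C u) v = L2_inner u (B v) + L2_inner u (D v)"
      using assms u v mem by (simp add: L2_inner_add_left is_adjoint_def)
    also have "\<dots> = cnj (L2_inner (B v + D v) u)"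
      using u mem by (simp add: L2_inner_add_left L2_inner_cnj[of u])
    finally show ?thesis by (simp add: L2_inner_cnj[of u])
  qed
  then show ?thesis
    unfolding is_adjoint_def using bd by (simp add: bounded_ops_add op_apply)
qed

lemma is_adjoint_scale:
  assumes "is_adjoint A B"
  shows "is_adjoint (op_scale 2 c A) (op_scale 2 (cnj c) B)"
proof -
  have "L2_inner (ae_scale c (A u)) v = L2_inner u (ae_scale (cnj c) (B v))"
    if "u \<in> Lp 2" "v \<in> Lp 2" for u v
    using assms that
    by (simp add: L2_inner_scale_left is_adjoint_def L2_inner_cnj[of u])
  then show ?thesis
    using assms by (simp add: is_adjoint_def bounded_ops_scale op_apply)
qed

lemma is_adjoint_mult:
  assumes "is_adjoint A B" "is_adjoint C D"
  shows "is_adjoint (op_mult 2 A C) (op_mult 2 D B)"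
proof -
  have bd: "A \<in> bounded_ops 2" "B \<in> bounded_ops 2" "C \<in> bounded_ops 2" "D \<in> bounded_ops 2"
    using assms by (auto simp: is_adjoint_def)
  have "L2_inner (A (C u)) v = L2_inner u (D (B v))" if u: "u \<in> Lp 2" and v: "v \<in> Lp 2" for u v
    using assms u v bounded_opsD(1)[OF bd(3) u] bounded_opsD(1)[OF bd(2) v] by (simp add: is_adjoint_def)
  then show ?thesis
    unfolding is_adjoint_def using bd by (simp add: bounded_ops_mult op_apply)
qed

text \<open>Adjoints are additive, conjugate scalars and reverse products, so closure of the
  generators under adjoints propagates by induction. The adjoint is tracked as a member of the
  algebra, as \<open>star_algebra\<close> demands.\<close>

lemma star_algebra_generated:
  assumes G: "G \<subseteq> bounded_ops 2" and adj: "\<And>A. A \<in> G \<Longrightarrow> \<exists>B\<in>G. is_adjoint A B"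
  shows "star_algebra (generated_algebra 2 G)"
proof -
  have "\<exists>B\<in>generated_algebra 2 G. is_adjoint A B" if "A \<in> generated_algebra 2 G" for A
    using that
    by induction (meson adj generated_algebra.intros is_adjoint_zero is_adjoint_add is_adjoint_scale is_adjoint_mult)+
  then show ?thesis
    using operator_algebra_generated[OF L2_exponent G] by (simp add: star_algebra_def)
qed

lemma is_adjoint_T_op_S_op:
  assumes m: "m \<ge> 1"
  shows "is_adjoint (T_op 2 m) (S_op 2 m)"
proof -
  have "L2_inner (T_op 2 m u) v = L2_inner u (S_op 2 m v)" if u: "u \<in> Lp 2" and v: "v \<in> Lp 2" for u v
  proof -
    obtain f g where f: "u = ae_class f" and g: "v = ae_class g" by (metis ae_fun_cases)
    \<comment> \<open>These lie in the classes of \<open>f\<close> and \<open>g\<close>, but obey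
      the relations on the whole plane, which the substitutions below use outside the
      square.\<close>
    let ?F = "\<lambda>x. twisted_ext f (fst x) (snd x)" and ?G = "\<lambda>x. twisted_ext g (fst x) (snd x)"
    have F: "ae_class ?F \<in> Lp 2" and G: "ae_class ?G \<in> Lp 2"
      using u v AE_twisted_ext_eq[of f] AE_twisted_ext_eq[of g] by (simp_all add: f g ae_class_eq_iff[symmetric])
    have fm: "f \<in> borel_measurable box_measure" and gm: "g \<in> borel_measurable box_measure"
      using u v by (simp_all add: f g ae_class_in_Lp_iff)
    \<comment> \<open>Boundedness of weighted pullbacks supplies square integrability of every
      factor, hence integrability of all products that are split into sums.\<close>
    have pull: "ae_class (\<lambda>x. w x * twisted_ext h (\<alpha> * fst x + \<beta>) (\<gamma> * snd x + \<delta>)) \<in> Lp 2"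
      if "ae_class h \<in> Lp 2" "\<alpha> \<noteq> 0" "\<gamma> \<noteq> 0" "w \<in> borel_measurable lebesgue" "\<And>x. norm (w x) \<le> 1"
      for h w \<alpha> \<beta> \<gamma> \<delta>
      using extends_to_boundedD(3)[OF extends_to_bounded_weighted_pullback[OF L2_exponent that(2-5)] that(1)]
      by (simp add: weighted_pullback_def axis_affine_def)
    define P where "P x = twisted_ext f (fst x) (real m * snd x) * cnj (twisted_ext g (real m * fst x) (snd x))" for x
    have P: "P \<in> borel_measurable lebesgue"
    proof -
      have "weighted_pullback (\<lambda>_. 1) (axis_affine 1 0 (real m) 0) f \<in> borel_measurable lebesgue"
        "weighted_pullback (\<lambda>_. 1) (axis_affine (real m) 0 1 0) g \<in> borel_measurable lebesgue"
        using m fm gm by (simp_all add: borel_measurable_weighted_pullback)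
      then show ?thesis unfolding P_def weighted_pullback_def axis_affine_def
        by (intro borel_measurable_times borel_measurable_continuous_on[of cnj]) (auto intro!: continuous_intros)
    qed
    \<comment> \<open>Moving the second variable into a horizontal strip shifts the argument of the
      extension of \<open>f\<close> by \<open>k\<close>; the resulting twist is the conjugate of the
      weight in \<open>hecke_S\<close>.\<close>
    have P_snd: "P (fst x, (snd x + real k) / real m) =
        ?F x * cnj (expi2pi (real k * fst x) * twisted_ext g (real m * fst x) ((snd x + real k) / real m))" for x k
    proof -
      have "real m * ((snd x + real k) / real m) = snd x + of_int (int k)" using m by simp
      then have "twisted_ext f (fst x) (real m * ((snd x + real k) / real m)) =
          expi2pi (- (fst x * real k)) * ?F x"
        using twisted_ext_add_of_int_snd[of f "fst x" "snd x" "int k"] by simp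
      then show ?thesis by (simp add: P_def cnj_expi2pi mult_ac)
    qed
    have intP: "integrable box_measure P"
      unfolding P_def using u v m pull[of f 1 "real m" "\<lambda>_. 1" 0 0] pull[of g "real m" 1 "\<lambda>_. 1" 0 0]
      by (intro L2_integrable_mult_cnj) (simp_all add: f g)
    have "L2_inner (T_op 2 m u) v = (LINT x|box_measure. hecke_T m f x * cnj (?G x))"
      using u m AE_twisted_ext_eq[of g] unfolding f g T_op_apply[OF L2_exponent m u[unfolded f]] L2_inner.abs_eq
      by (intro integral_box_AE_cong) (auto elim: eventually_mono)
    also have "\<dots> = (LINT x|box_measure. 1 / of_nat m * (\<Sum>k<m. P ((fst x + real k) / real m, snd x)))"
    proof (intro Bochner_Integration.integral_cong refl)
      fix x :: "real \<times> real"
      \<comment> \<open>In the vertical strips the extension of \<open>g\<close> is only shifted by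
        the integer \<open>k\<close> in its first variable, so it is common to all summands.\<close>
      have "P ((fst x + real k) / real m, snd x) =
          twisted_ext f ((fst x + real k) / real m) (real m * snd x) * cnj (?G x)" for k
        using m twisted_ext_add_of_int_fst[of g "fst x" "int k" "snd x"] by (simp add: P_def)
      then show "hecke_T m f x * cnj (?G x) = 1 / of_nat m * (\<Sum>k<m. P ((fst x + real k) / real m, snd x))"
        by (simp add: hecke_T_def case_prod_beta atLeast0LessThan sum_distrib_right mult.assoc)
    qed
    also have "\<dots> = 1 / of_nat m * (\<Sum>k<m. LINT x|box_measure. P ((fst x + real k) / real m, snd x))"
    proof -
      have "integrable box_measure (\<lambda>x. P ((fst x + real k) / real m, snd x))" for k
      proof -
        have "integrable box_measure (\<lambda>x. twisted_ext f (1 / real m * fst x + real k / real m) (real m * snd x) *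
            cnj (?G x))"
          using u m pull[of f "1 / real m" "real m" "\<lambda>_. 1" "real k / real m" 0]
          by (intro L2_integrable_mult_cnj G) (simp add: f)
        moreover have "twisted_ext g (real m * ((a + real k) / real m)) c = twisted_ext g a c" for a c
          using m twisted_ext_add_of_int_fst[of g a "int k" c] by simp
        ultimately show ?thesis by (simp add: P_def add_divide_distrib)
      qed
      then show ?thesis by simp
    qed
    also have "\<dots> = (LINT x|box_measure. P x)" by (rule integral_box_average(1)[OF m P intP])
    also have "\<dots> = 1 / of_nat m * (\<Sum>k<m. LINT x|box_measure. P (fst x, (snd x + real k) / real m))"
      by (rule integral_box_average(2)[OF m P intP, symmetric])
    also have "\<dots> = (LINT x|box_measure. 1 / of_nat m * (\<Sum>k<m. P (fst x, (snd x + real k) / real m)))"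
    proof -
      have "integrable box_measure (\<lambda>x. P (fst x, (snd x + real k) / real m))" for k
      proof -
        have "integrable box_measure (\<lambda>x. ?F x *
            cnj (expi2pi (real k * fst x) * twisted_ext g (real m * fst x + 0) (1 / real m * snd x + real k / real m)))"
          using v m pull[of g "real m" "1 / real m" "\<lambda>x. expi2pi (real k * fst x)" 0 "real k / real m"]
            borel_measurable_expi2pi_fst[of k 1]
          by (intro L2_integrable_mult_cnj F) (simp add: g)
        then show ?thesis unfolding P_snd by (simp add: add_divide_distrib)
      qed
      then show ?thesis by simp
    qed
    also have "\<dots> = (LINT x|box_measure. ?F x * cnj (hecke_S m g x))"
      by (intro Bochner_Integration.integral_cong refl)
        (simp add: P_snd hecke_S_def case_prod_beta atLeast0LessThan sum_distrib_left mult_ac)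
    also have "\<dots> = L2_inner u (S_op 2 m v)"
      using v m AE_twisted_ext_eq[of f] unfolding f g S_op_apply[OF L2_exponent m v[unfolded g]] L2_inner.abs_eq
      by (intro integral_box_AE_cong) (auto elim: eventually_mono)
    finally show ?thesis .
  qed
  then show ?thesis using m by (simp add: is_adjoint_def T_op_bounded S_op_bounded)
qed


section \<open>Generators of the algebra and the final statement\<close>

definition hecke_generators :: "ennreal \<Rightarrow> lp_operator set" where
  "hecke_generators p = {T_op p m | m. m \<ge> 1} \<union> {S_op p m | m. m \<ge> 1}"

text \<open>The two dual families coincide with T_m and S_m, so commutation and adjoints have to be
  checked for two kinds of generators only.\<close>

lemma hecke_algebra_eq: "hecke_algebra p = generated_algebra p (hecke_generators p)"
proof -
  have "(\<Union>m\<in>{1..}. {T_op p m, S_op p m, T_vee_op p m, S_vee_op p m}) = hecke_generators p"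
    by (auto simp: hecke_generators_def T_vee_op_eq S_vee_op_eq)
  then show ?thesis by (simp add: hecke_algebra_def)
qed

lemma hecke_generators_bounded: "1 \<le> p \<Longrightarrow> hecke_generators p \<subseteq> bounded_ops p"
  by (auto simp: hecke_generators_def T_op_bounded S_op_bounded)

theorem theorem2p1:
  fixes p :: ennreal
  assumes "1 \<le> p"
  shows
    "(\<forall>m\<ge>1.
        extends_to_bounded p (hecke_T m) \<and> extends_to_bounded p (hecke_S m) \<and>
        extends_to_bounded p (hecke_T_vee m) \<and> extends_to_bounded p (hecke_S_vee m) \<and>
        T_op p m = T_vee_op p m \<and> S_op p m = S_vee_op p m \<and>
        invertible_op p (T_op p m) \<and>
        S_op p m = op_scale p (1 / of_nat m) (op_inverse p (T_op p m)))
     \<and> (operator_algebra p (hecke_algebra p) \<and> commutative_ops p (hecke_algebra p))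
     \<and> ((\<forall>m\<ge>1. is_adjoint (T_op 2 m) (S_op 2 m) \<and> is_adjoint (S_op 2 m) (T_op 2 m)) \<and>
        star_algebra (hecke_algebra 2) \<and>
        (\<forall>m\<ge>1. unitary_op (op_scale 2 (of_real (sqrt (real m))) (T_op 2 m)) \<and>
               unitary_op (op_scale 2 (of_real (sqrt (real m))) (S_op 2 m))))"
proof (intro conjI allI impI)
  fix m :: nat
  assume m: "1 \<le> m"
  have T: "T_op p m \<in> bounded_ops p" and S: "S_op p m \<in> bounded_ops p"
    using assms m by (simp_all add: T_op_bounded S_op_bounded)
  have id: "op_id p \<in> bounded_ops p" using assms by (rule bounded_ops_id)
  show "extends_to_bounded p (hecke_T m)" "extends_to_bounded p (hecke_S m)"
    using assms m by (simp_all add: extends_to_bounded_hecke)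
  moreover have "hecke_T_vee m = hecke_T m" "hecke_S_vee m = hecke_S m"
    using m by (simp_all add: fun_eq_iff hecke_T_vee_eq hecke_S_vee_eq)
  ultimately show "extends_to_bounded p (hecke_T_vee m)" "extends_to_bounded p (hecke_S_vee m)"
    by simp_all
  show "T_op p m = T_vee_op p m" "S_op p m = S_vee_op p m"
    using m by (simp_all add: T_vee_op_eq S_vee_op_eq)
  \<comment> \<open>Since T_m and S_m multiply to \<open>1 / m\<close> in either order, the inverse
    of T_m is \<open>m\<close> times S_m.\<close>
  define B where "B = op_scale p (of_nat m) (S_op p m)"
  have B: "B \<in> bounded_ops p" using assms S by (simp add: B_def bounded_ops_scale)
  have TB: "op_mult p (T_op p m) B = op_id p" and BT: "op_mult p B (T_op p m) = op_id p"
    using assms m T S id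
    by (simp_all add: B_def op_mult_scale T_op_S_op S_op_T_op op_scale_scale op_scale_one)
  show "invertible_op p (T_op p m)"
    unfolding invertible_op_def using T B TB BT by blast
  show "S_op p m = op_scale p (1 / of_nat m) (op_inverse p (T_op p m))"
    unfolding op_inverse_eqI[OF T B TB BT] using m S by (simp add: B_def op_scale_scale op_scale_one)
  show adj: "is_adjoint (T_op 2 m) (S_op 2 m)" using m by (rule is_adjoint_T_op_S_op)
  then show "is_adjoint (S_op 2 m) (T_op 2 m)" by (rule is_adjoint_sym)
  let ?s = "of_real (sqrt (real m)) :: complex"
  \<comment> \<open>A real scalar is its own conjugate, so the adjoint carries the same square root;
    the product of the two roots cancels the \<open>1 / m\<close> from T_m S_m and S_m T_m.\<close>
  have adj': "is_adjoint (op_scale 2 ?s (T_op 2 m)) (op_scale 2 ?s (S_op 2 m))"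
    using is_adjoint_scale[OF adj, of ?s] by simp
  have ss: "?s * ?s = of_nat m" by (simp add: of_real_mult[symmetric] del: of_real_mult)
  have inv: "op_mult 2 (op_scale 2 ?s (T_op 2 m)) (op_scale 2 ?s (S_op 2 m)) = op_id 2"
    "op_mult 2 (op_scale 2 ?s (S_op 2 m)) (op_scale 2 ?s (T_op 2 m)) = op_id 2"
    using m L2_exponent ss
    by (simp_all add: op_mult_scale T_op_bounded S_op_bounded bounded_ops_scale bounded_ops_id
        T_op_S_op S_op_T_op op_scale_scale op_scale_one mult.assoc[symmetric])
  show "unitary_op (op_scale 2 ?s (T_op 2 m))" "unitary_op (op_scale 2 ?s (S_op 2 m))"
    unfolding unitary_op_def using adj' is_adjoint_sym[OF adj'] inv by blast+
next
  show "operator_algebra p (hecke_algebra p)" "commutative_ops p (hecke_algebra p)"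
    unfolding hecke_algebra_eq
    using assms hecke_generators_bounded[OF assms] hecke_ops_commute[OF assms]
    by (auto intro!: operator_algebra_generated commutative_generated_algebra simp: hecke_generators_def)
  have "\<exists>B\<in>hecke_generators 2. is_adjoint A B" if "A \<in> hecke_generators 2" for A
    using that is_adjoint_T_op_S_op is_adjoint_sym unfolding hecke_generators_def by blast
  then show "star_algebra (hecke_algebra 2)"
    unfolding hecke_algebra_eq
    by (intro star_algebra_generated hecke_generators_bounded L2_exponent)
qed

end
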